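(* Let $f:\mathbb Z^3\to\mathbb R^N$ be a Q-net with non-degenerate elementary hexahedra (for every $u$ the points $f,f_1,f_2,f_3$ span a $3$-dimensional affine subspace, and the hexahedron is in general position). For each elementary hexahedron with vertices $f,f_i,f_{ij},f_{123}$, the four vertices $f,f_{12},f_{23},f_{13}$ are coplanar if and only if the four vertices $f_1,f_2,f_3,f_{123}$ are coplanar. Moreover, $f$ is a discrete Koenigs net if and only if for every elementary hexahedron these (equivalent) coplanarity conditions hold.
   Context: Let $N\ge 3$. For a map $f:\mathbb Z^3\to\mathbb R^N$, write $e_i$ for the $i$-th unit vector, $f=f(u)$, $f_i=f(u+e_i)$, $f_{ij}=f(u+e_i+e_j)$, $f_{123}=f(u+e_1+e_2+e_3)$, $\delta_i f=f_i-f$. A Q-net is a map such that for every $u$ and $i\ne j$ the elementary quadrilateral $(f,f_i,f_{ij},f_j)$ is planar; elementary quadrilaterals are assumed non-degenerate: four distinct vertices, no three collinear, and the diagonals $(ff_{ij})$, $(f_if_j)$ meet in a point different from all vertices. Two planar quadrilaterals $(A,B,C,D)$, $(A^*,B^*,C^*,D^* )$ are dual if corresponding sides are parallel ($A^*B^*\parallel AB$, $B^*C^*\parallel BC$, $C^*D^*\parallel CD$, $D^*A^*\parallel DA$) and non-corresponding diagonals are parallel ($A^*C^*\parallel BD$, $B^*D^*\parallel AC$). A Q-net $f$ is a discrete Koenigs net if there is a Q-net $f^*$ (a dual net) such that each $(f^*,f^*_i,f^*_{ij},f^*_j)$ is dual to $(f,f_i,f_{ij},f_j)$, i.e. $\delta_if^*\parallel\delta_if$,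 $\delta_jf^*\parallel\delta_jf$, $f^*_{ij}-f^*\parallel f_i-f_j$, $f^*_i-f^*_j\parallel f_{ij}-f$. *)

theory Defs
  imports "HOL-Analysis.Analysis"
begin

type_synonym lat = "int \<times> int \<times> int"

definition unitv :: "nat \<Rightarrow> lat" where
  "unitv i = (if i = 1 then (1,0,0) else if i = 2 then (0,1,0) else (0,0,1))"

definition latadd :: "lat \<Rightarrow> lat \<Rightarrow> lat" where
  "latadd u v = (fst u + fst v, fst (snd u) + fst (snd v), snd (snd u) + snd (snd v))"

definition sh :: "nat \<Rightarrow> lat \<Rightarrow> lat" where
  "sh i u = latadd u (unitv i)"

definition dirs :: "nat set" where "dirs = {1,2,3}"

definition parallel :: "'a::real_vector \<Rightarrow> 'a \<Rightarrow> bool" where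
  "parallel v w \<longleftrightarrow> (\<exists>c. v = c *\<^sub>R w) \<or> (\<exists>c. w = c *\<^sub>R v)"

definition nondeg_quad :: "'a::euclidean_space \<Rightarrow> 'a \<Rightarrow> 'a \<Rightarrow> 'a \<Rightarrow> bool" where
  "nondeg_quad A B C D \<longleftrightarrow>
     distinct [A,B,C,D] \<and>
     \<not> collinear {A,B,C} \<and> \<not> collinear {A,B,D} \<and> \<not> collinear {A,C,D} \<and> \<not> collinear {B,C,D} \<and>
     (\<exists>p. p \<in> affine hull {A,C} \<and> p \<in> affine hull {B,D} \<and> p \<notin> {A,B,C,D})"

definition planar_quad :: "'a::euclidean_space \<Rightarrow> 'a \<Rightarrow> 'a \<Rightarrow> 'a \<Rightarrow> bool" where
  "planar_quad A B C D \<longleftrightarrow> coplanar {A,B,C,D}"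

definition qnet :: "(lat \<Rightarrow> 'a::euclidean_space) \<Rightarrow> bool" where
  "qnet f \<longleftrightarrow> (\<forall>u i j. i \<in> dirs \<longrightarrow> j \<in> dirs \<longrightarrow> i \<noteq> j \<longrightarrow>
      planar_quad (f u) (f (sh i u)) (f (sh j (sh i u))) (f (sh j u)) \<and>
      nondeg_quad (f u) (f (sh i u)) (f (sh j (sh i u))) (f (sh j u)))"

definition dual_quad :: "'a::real_vector \<Rightarrow> 'a \<Rightarrow> 'a \<Rightarrow> 'a \<Rightarrow> 'a \<Rightarrow> 'a \<Rightarrow> 'a \<Rightarrow> 'a \<Rightarrow> bool" where
  "dual_quad A B C D A' B' C' D' \<longleftrightarrow>
     parallel (B' - A') (B - A) \<and> parallel (C' - B') (C - B) \<and>
     parallel (D' - C') (D - C) \<and> parallel (A' - D') (A - D) \<and>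
     parallel (C' - A') (D - B) \<and> parallel (D' - B') (C - A)"

definition koenigs :: "(lat \<Rightarrow> 'a::euclidean_space) \<Rightarrow> bool" where
  "koenigs f \<longleftrightarrow> qnet f \<and> (\<exists>fs :: lat \<Rightarrow> 'a. qnet fs \<and>
     (\<forall>u i j. i \<in> dirs \<longrightarrow> j \<in> dirs \<longrightarrow> i \<noteq> j \<longrightarrow>
        dual_quad (f u) (f (sh i u)) (f (sh j (sh i u))) (f (sh j u))
                  (fs u) (fs (sh i u)) (fs (sh j (sh i u))) (fs (sh j u))))"

definition hex_vertices :: "(lat \<Rightarrow> 'a) \<Rightarrow> lat \<Rightarrow> 'a set" where
  "hex_vertices f u = {f u, f (sh 1 u), f (sh 2 u), f (sh 3 u),
     f (sh 2 (sh 1 u)), f (sh 3 (sh 2 u)), f (sh 3 (sh 1 u)), f (sh 3 (sh 2 (sh 1 u)))}"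

definition nondeg_hex :: "(lat \<Rightarrow> 'a::euclidean_space) \<Rightarrow> lat \<Rightarrow> bool" where
  "nondeg_hex f u \<longleftrightarrow>
     aff_dim {f u, f (sh 1 u), f (sh 2 u), f (sh 3 u)} = 3 \<and>
     card (hex_vertices f u) = 8 \<and>
     (\<forall>a\<in>hex_vertices f u. \<forall>b\<in>hex_vertices f u. \<forall>c\<in>hex_vertices f u.
        distinct [a,b,c] \<longrightarrow> \<not> collinear {a,b,c})"

end

(* In the frame of the edge vectors d_i = f_i - f write f_ij - f = a_ij d_i + a_ji d_j.  The points
   f, f_12, f_23, f_13 are coplanar iff (K)  a_12 a_23 a_31 + a_21 a_32 a_13 = 0.  Writing
   f_123 - f = x d_1 + y d_2 + z d_3, the planarity of the three faces through f_123 is a linear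
   system in x, y, z with right-hand side 1 - x - y - z in every equation; its determinant is
   a multiple of (K).  As f_12, f_23, f_13 are not collinear, this yields (K) iff x + y + z = 1,
   that is, f_1, f_2, f_3, f_123 coplanar.

   A dual net has edges c_i d_i, and duality of the face (i,j) means
   c_i a_ji = - c_j a_ij  and  c_j(u + e_i) = c_i(u) / (1 - a_ij(u) - a_ji(u)).
   Eliminating the c_i around f gives (K).  Conversely, (K) makes these relations solvable on the
   twelve edges of each hexahedron, uniquely up to a factor; the factors of neighbouring hexahedra
   are compared along shared edges, which gives a flat connection on Z^3 and hence a global
   solution.  The 1-form c_i d_i is then closed, and its primitive is the dual net. *)
theory Submission
  imports Defs
begin

section \<open>Coplanarity and planar quadrilaterals\<close>

text \<open>Coefficients are used rather than independence of the set \<open>{v, w}\<close>, so that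
  \<open>v = w\<close> counts as dependent. The same applies to \<open>indep3\<close>.\<close>

definition indep2 :: "'a::real_vector \<Rightarrow> 'a \<Rightarrow> bool" where
  "indep2 v w \<longleftrightarrow> (\<forall>x y. x *\<^sub>R v + y *\<^sub>R w = 0 \<longrightarrow> x = 0 \<and> y = 0)"

definition indep3 :: "'a::real_vector \<Rightarrow> 'a \<Rightarrow> 'a \<Rightarrow> bool" where
  "indep3 v w t \<longleftrightarrow> (\<forall>x y z. x *\<^sub>R v + y *\<^sub>R w + z *\<^sub>R t = 0 \<longrightarrow> x = 0 \<and> y = 0 \<and> z = 0)"

lemma indep2D:
  assumes "indep2 v w" "x *\<^sub>R v + y *\<^sub>R w = x' *\<^sub>R v + y' *\<^sub>R w"
  shows "x = x'" "y = y'"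
proof -
  have "(x - x') *\<^sub>R v + (y - y') *\<^sub>R w = 0"
    using assms(2) by (simp add: algebra_simps)
  then show "x = x'" "y = y'"
    using assms(1) unfolding indep2_def by (metis eq_iff_diff_eq_0)+
qed

lemma indep3D:
  assumes "indep3 v w t"
    "x *\<^sub>R v + y *\<^sub>R w + z *\<^sub>R t = x' *\<^sub>R v + y' *\<^sub>R w + z' *\<^sub>R t"
  shows "x = x'" "y = y'" "z = z'"
proof -
  have "(x - x') *\<^sub>R v + (y - y') *\<^sub>R w + (z - z') *\<^sub>R t = 0"
    using assms(2) by (simp add: algebra_simps)
  then show "x = x'" "y = y'" "z = z'"
    using assms(1) unfolding indep3_def by (metis eq_iff_diff_eq_0)+
qed

lemma indep2_scale:
  assumes "indep2 v w" "b \<noteq> 0" "d \<noteq> 0"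
  shows "indep2 (b *\<^sub>R v) (d *\<^sub>R w)"
  using assms unfolding indep2_def by fastforce

lemma indep2_commute: "indep2 v w \<Longrightarrow> indep2 w v"
  unfolding indep2_def by (metis add.commute)

lemma indep2_iff_not_collinear:
  fixes A :: "'a::euclidean_space"
  shows "indep2 (B - A) (D - A) \<longleftrightarrow> \<not> collinear {A, B, D}"
proof -
  have "collinear {A, B, D} \<longleftrightarrow> collinear {0, B - A, D - A}"
    by (simp add: collinear_3[unfolded NO_MATCH_def, OF TrueI, of B A D] insert_commute[of A B])
  also have "\<dots> \<longleftrightarrow> \<not> indep2 (B - A) (D - A)"
  proof
    assume "collinear {0, B - A, D - A}"
    then consider "B - A = 0" | "D - A = 0" | c where "D - A = c *\<^sub>R (B - A)"
      unfolding collinear_lemma by blast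
    then show "\<not> indep2 (B - A) (D - A)"
    proof cases
      case 1
      then have "1 *\<^sub>R (B - A) + 0 *\<^sub>R (D - A) = 0" by simp
      then show ?thesis unfolding indep2_def by (metis zero_neq_one)
    next
      case 2
      then have "0 *\<^sub>R (B - A) + 1 *\<^sub>R (D - A) = 0" by simp
      then show ?thesis unfolding indep2_def by (metis zero_neq_one)
    next
      case 3
      then have "(- c) *\<^sub>R (B - A) + 1 *\<^sub>R (D - A) = 0" by simp
      then show ?thesis unfolding indep2_def by (metis zero_neq_one)
    qed
  next
    assume "\<not> indep2 (B - A) (D - A)"
    then obtain x y where xy: "x *\<^sub>R (B - A) + y *\<^sub>R (D - A) = 0" "x \<noteq> 0 \<or> y \<noteq> 0"
      unfolding indep2_def by blast
    show "collinear {0, B - A, D - A}"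
    proof (cases "y = 0")
      case True
      then show ?thesis using xy unfolding collinear_lemma by auto
    next
      case False
      have "y *\<^sub>R (D - A) = y *\<^sub>R ((- x / y) *\<^sub>R (B - A))"
        using xy(1) False by (simp add: eq_neg_iff_add_eq_0 add.commute)
      then have "D - A = (- x / y) *\<^sub>R (B - A)"
        using False by (metis real_vector.scale_cancel_left)
      then show ?thesis unfolding collinear_lemma by blast
    qed
  qed
  finally show ?thesis by blast
qed

text \<open>The cross product serves when it is nonzero. If it vanishes, the two vectors are
  parallel, and a quarter turn of a nonzero projection to the first two coordinates is orthogonal to
  both; if both projections vanish, the first unit vector is. The result supplies a linear relation
  among any three vectors of a plane.\<close>

lemma ex_orthogonal_to_two:
  fixes a1 a2 a3 b1 b2 b3 :: real
  shows "\<exists>p q r. (p, q, r) \<noteq> (0, 0, 0) \<and> p * a1 + q * a2 + r * a3 = 0 \<and> p * b1 + q * b2 + r * b3 = 0"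
proof (cases "(a2 * b3 - a3 * b2, a3 * b1 - a1 * b3, a1 * b2 - a2 * b1) = (0, 0, 0)")
  case False
  moreover have "(a2 * b3 - a3 * b2) * a1 + (a3 * b1 - a1 * b3) * a2 + (a1 * b2 - a2 * b1) * a3 = 0"
    "(a2 * b3 - a3 * b2) * b1 + (a3 * b1 - a1 * b3) * b2 + (a1 * b2 - a2 * b1) * b3 = 0"
    by (simp_all add: algebra_simps)
  ultimately show ?thesis by metis
next
  case True
  then have eq: "a2 * b3 = a3 * b2" "a3 * b1 = a1 * b3" "a1 * b2 = a2 * b1" by auto
  consider "a1 \<noteq> 0 \<or> a2 \<noteq> 0" | "b1 \<noteq> 0 \<or> b2 \<noteq> 0" | "a1 = 0" "a2 = 0" "b1 = 0" "b2 = 0"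
    by blast
  then show ?thesis
  proof cases
    case 1
    have "(a2, - a1, 0) \<noteq> (0, 0, 0)" "a2 * a1 + (- a1) * a2 + 0 * a3 = 0"
      "a2 * b1 + (- a1) * b2 + 0 * b3 = 0"
      using 1 eq by auto
    then show ?thesis by metis
  next
    case 2
    have "(b2, - b1, 0) \<noteq> (0, 0, 0)" "b2 * a1 + (- b1) * a2 + 0 * a3 = 0"
      "b2 * b1 + (- b1) * b2 + 0 * b3 = 0"
      using 2 eq by (auto simp: algebra_simps)
    then show ?thesis by metis
  next
    case 3
    then have "(1 :: real, 0 :: real, 0 :: real) \<noteq> (0, 0, 0)" "1 * a1 + 0 * a2 + 0 * a3 = 0" "1 * b1 + 0 * b2 + 0 * b3 = 0"
      by auto
    then show ?thesis by metis
  qed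
qed

text \<open>Three difference vectors in a plane have two coordinates each, and a vector orthogonal
  to both coordinate rows is a relation between them. Conversely, a relation can be solved for a
  point with nonzero coefficient, which puts that point into the affine hull of the other
  three.\<close>

lemma coplanar_4_iff:
  fixes A :: "'a::euclidean_space"
  shows "coplanar {A, B, C, D} \<longleftrightarrow> \<not> indep3 (B - A) (C - A) (D - A)"
proof
  assume "coplanar {A, B, C, D}"
  then obtain u v w where sub: "{A, B, C, D} \<subseteq> affine hull {u, v, w}"
    unfolding coplanar_def by blast
  have repr: "\<exists>x y. P = u + x *\<^sub>R (v - u) + y *\<^sub>R (w - u)" if P: "P \<in> affine hull {u, v, w}" for P
  proof -
    obtain a b c where "a + b + c = 1" "P = a *\<^sub>R u + b *\<^sub>R v + c *\<^sub>R w"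
      using P unfolding affine_hull_3 by blast
    moreover from this have "a = 1 - b - c" by simp
    ultimately have "P = u + b *\<^sub>R (v - u) + c *\<^sub>R (w - u)"
      by (simp add: algebra_simps)
    then show ?thesis by blast
  qed
  obtain a0 b0 where A: "A = u + a0 *\<^sub>R (v - u) + b0 *\<^sub>R (w - u)" using repr sub by blast
  obtain a1 b1 where B: "B = u + a1 *\<^sub>R (v - u) + b1 *\<^sub>R (w - u)" using repr sub by blast
  obtain a2 b2 where C: "C = u + a2 *\<^sub>R (v - u) + b2 *\<^sub>R (w - u)" using repr sub by blast
  obtain a3 b3 where D: "D = u + a3 *\<^sub>R (v - u) + b3 *\<^sub>R (w - u)" using repr sub by blast
  obtain p q r where pqr: "(p, q, r) \<noteq> (0, 0, 0)"
    "p * (a1 - a0) + q * (a2 - a0) + r * (a3 - a0) = 0"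
    "p * (b1 - b0) + q * (b2 - b0) + r * (b3 - b0) = 0"
    using ex_orthogonal_to_two by metis
  have "p *\<^sub>R (B - A) + q *\<^sub>R (C - A) + r *\<^sub>R (D - A) =
      (p * (a1 - a0) + q * (a2 - a0) + r * (a3 - a0)) *\<^sub>R (v - u) +
      (p * (b1 - b0) + q * (b2 - b0) + r * (b3 - b0)) *\<^sub>R (w - u)"
    unfolding A B C D by (simp add: algebra_simps)
  also have "\<dots> = 0" using pqr by simp
  finally show "\<not> indep3 (B - A) (C - A) (D - A)"
    using pqr(1) unfolding indep3_def by blast
next
  have step: "coplanar {A, B, C, D}"
    if rel: "p *\<^sub>R (B - A) + q *\<^sub>R (C - A) + r *\<^sub>R (D - A) = 0" "p \<noteq> 0" for p q r and B C D :: 'a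
  proof -
    have "B = (1 + q / p + r / p) *\<^sub>R A + (- q / p) *\<^sub>R C + (- r / p) *\<^sub>R D"
    proof -
      have "p *\<^sub>R B = p *\<^sub>R ((1 + q / p + r / p) *\<^sub>R A + (- q / p) *\<^sub>R C + (- r / p) *\<^sub>R D)"
        using rel by (simp add: algebra_simps add_divide_distrib)
      then show ?thesis using rel(2) by (metis real_vector.scale_cancel_left)
    qed
    moreover have "(1 + q / p + r / p) + (- q / p) + (- r / p) = 1" by simp
    ultimately have "B \<in> affine hull {A, C, D}"
      unfolding affine_hull_3 by blast
    then have "{A, B, C, D} \<subseteq> affine hull {A, C, D}"
      by (auto intro: hull_inc)
    then show ?thesis unfolding coplanar_def by blast
  qed
  assume "\<not> indep3 (B - A) (C - A) (D - A)"
  then obtain p q r where rel: "p *\<^sub>R (B - A) + q *\<^sub>R (C - A) + r *\<^sub>R (D - A) = 0"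
      and "p \<noteq> 0 \<or> q \<noteq> 0 \<or> r \<noteq> 0"
    unfolding indep3_def by blast
  then consider "p \<noteq> 0" | "q \<noteq> 0" | "r \<noteq> 0" by blast
  then show "coplanar {A, B, C, D}"
  proof cases
    case 1
    then show ?thesis using step rel by blast
  next
    case 2
    then have "coplanar {A, C, B, D}" using step[of q C p B r D] rel by (simp add: algebra_simps)
    then show ?thesis by (simp add: insert_commute)
  next
    case 3
    then have "coplanar {A, D, B, C}" using step[of r D p B q C] rel by (simp add: algebra_simps)
    then show ?thesis by (simp add: insert_commute)
  qed
qed

lemma indep3_if_aff_dim:
  fixes A :: "'a::euclidean_space"
  assumes "aff_dim {A, B, C, D} = 3"
  shows "indep3 (B - A) (C - A) (D - A)"
proof (rule ccontr)
  assume "\<not> ?thesis"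
  then obtain u v w where "{A, B, C, D} \<subseteq> affine hull {u, v, w}"
    using coplanar_4_iff unfolding coplanar_def by blast
  then have "aff_dim {A, B, C, D} \<le> aff_dim {u, v, w}"
    by (metis aff_dim_affine_hull aff_dim_subset)
  also have "\<dots> \<le> int (card {u, v, w}) - 1"
    by (rule aff_dim_le_card) simp
  also have "\<dots> \<le> 2"
    using card_length[of "[u, v, w]"] by simp
  finally show False using assms by simp
qed

text \<open>Each degeneracy is a condition on the coordinates of \<open>C - A\<close>:
  \<open>b = 0\<close> or \<open>d = 0\<close> puts \<open>C\<close> on a side through
  \<open>A\<close>, \<open>b + d = 1\<close> puts \<open>C\<close> on the line \<open>BD\<close>,
  and \<open>b + d = 0\<close> makes the diagonals parallel. Once these are excluded, the diagonals
  meet, and the meeting point differs from the vertices because no three of them are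
  collinear.\<close>

lemma quad_iff_coefficients:
  fixes A :: "'a::euclidean_space"
  shows "planar_quad A B C D \<and> nondeg_quad A B C D \<longleftrightarrow>
    indep2 (B - A) (D - A) \<and>
    (\<exists>b d. C - A = b *\<^sub>R (B - A) + d *\<^sub>R (D - A) \<and> b \<noteq> 0 \<and> d \<noteq> 0 \<and> b + d \<noteq> 0 \<and> b + d \<noteq> 1)"
  (is "?L \<longleftrightarrow> ?R")
proof
  assume L: ?L
  then have nc: "\<not> collinear {A, B, C}" "\<not> collinear {A, B, D}" "\<not> collinear {A, C, D}"
      "\<not> collinear {B, C, D}"
    and ex: "\<exists>p. p \<in> affine hull {A, C} \<and> p \<in> affine hull {B, D} \<and> p \<notin> {A, B, C, D}"
    unfolding nondeg_quad_def by blast+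
  have ind: "indep2 (B - A) (D - A)" using nc(2) indep2_iff_not_collinear by blast
  have "\<not> indep3 (B - A) (C - A) (D - A)"
    using L coplanar_4_iff unfolding planar_quad_def by blast
  then obtain p q r where rel: "p *\<^sub>R (B - A) + q *\<^sub>R (C - A) + r *\<^sub>R (D - A) = 0"
      and nz: "p \<noteq> 0 \<or> q \<noteq> 0 \<or> r \<noteq> 0"
    unfolding indep3_def by blast
  have q: "q \<noteq> 0"
  proof
    assume "q = 0"
    then have "p *\<^sub>R (B - A) + r *\<^sub>R (D - A) = 0" using rel by simp
    then show False using ind nz \<open>q = 0\<close> unfolding indep2_def by blast
  qed
  define b d where "b = - p / q" and "d = - r / q"
  have "q *\<^sub>R (C - A) = q *\<^sub>R (b *\<^sub>R (B - A) + d *\<^sub>R (D - A))"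
    using rel q unfolding b_def d_def
    by (simp add: scaleR_add_right eq_neg_iff_add_eq_0 algebra_simps)
  then have CA: "C - A = b *\<^sub>R (B - A) + d *\<^sub>R (D - A)"
    using q by (metis real_vector.scale_cancel_left)
  have "indep2 (B - A) (C - A)" "indep2 (C - A) (D - A)"
    using nc indep2_iff_not_collinear by blast+
  moreover have "\<not> indep2 (B - A) (C - A)" if "d = 0"
  proof -
    have "b *\<^sub>R (B - A) + (- 1) *\<^sub>R (C - A) = 0" using CA that by simp
    then show ?thesis unfolding indep2_def by (metis neg_equal_0_iff_equal zero_neq_one)
  qed
  moreover have "\<not> indep2 (C - A) (D - A)" if "b = 0"
  proof -
    have "(- 1) *\<^sub>R (C - A) + d *\<^sub>R (D - A) = 0" using CA that by simp
    then show ?thesis unfolding indep2_def by (metis neg_equal_0_iff_equal zero_neq_one)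
  qed
  moreover have "b + d \<noteq> 1"
  proof
    assume "b + d = 1"
    then have b: "b = 1 - d" by simp
    have "C - B = d *\<^sub>R (D - B)" using CA unfolding b by (simp add: algebra_simps)
    then have "1 *\<^sub>R (C - B) + (- d) *\<^sub>R (D - B) = 0" by simp
    then have "\<not> indep2 (C - B) (D - B)" unfolding indep2_def by (metis zero_neq_one)
    then show False using nc(4) indep2_iff_not_collinear by blast
  qed
  moreover have "b + d \<noteq> 0"
  proof
    assume bd: "b + d = 0"
    obtain p where p: "p \<in> affine hull {A, C}" "p \<in> affine hull {B, D}" using ex by blast
    obtain x y where xy: "x + y = 1" "p = x *\<^sub>R A + y *\<^sub>R C"
      using p(1) unfolding affine_hull_2 by blast
    obtain z t where zt: "z + t = 1" "p = z *\<^sub>R B + t *\<^sub>R D"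
      using p(2) unfolding affine_hull_2 by blast
    have "p - A = y *\<^sub>R (C - A)"
    proof -
      have x: "x = 1 - y" using xy by simp
      show ?thesis using xy(2) unfolding x by (simp add: algebra_simps)
    qed
    then have "p - A = (y * b) *\<^sub>R (B - A) + (y * d) *\<^sub>R (D - A)"
      using CA by (simp add: scaleR_add_right)
    moreover have "p - A = z *\<^sub>R (B - A) + t *\<^sub>R (D - A)"
    proof -
      have z: "z = 1 - t" using zt by simp
      show ?thesis using zt(2) unfolding z by (simp add: algebra_simps)
    qed
    ultimately have "y * b = z" "y * d = t" using indep2D[OF ind] by metis+
    then have "z + t = y * (b + d)" by (simp add: algebra_simps)
    then show False using bd zt(1) by simp
  qed
  ultimately show ?R using ind CA by blast
next
  assume R: ?R
  then obtain b d where ind: "indep2 (B - A) (D - A)"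
    and CA: "C - A = b *\<^sub>R (B - A) + d *\<^sub>R (D - A)"
    and nz: "b \<noteq> 0" "d \<noteq> 0" "b + d \<noteq> 0" "b + d \<noteq> 1" by blast
  have C: "C = A + (b *\<^sub>R (B - A) + d *\<^sub>R (D - A))" using CA by (simp add: algebra_simps)
  have "b *\<^sub>R (B - A) + (- 1) *\<^sub>R (C - A) + d *\<^sub>R (D - A) = 0" unfolding CA by simp
  then have "planar_quad A B C D"
    unfolding planar_quad_def coplanar_4_iff indep3_def using nz by blast
  moreover have "\<not> collinear {A, B, D}" using ind indep2_iff_not_collinear by blast
  moreover have "indep2 (B - A) (C - A)"
    unfolding indep2_def
  proof (intro allI impI)
    fix x y assume "x *\<^sub>R (B - A) + y *\<^sub>R (C - A) = 0"
    then have "(x + y * b) *\<^sub>R (B - A) + (y * d) *\<^sub>R (D - A) = 0"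
      unfolding CA by (simp add: scaleR_add_left scaleR_add_right add.assoc)
    then have "x + y * b = 0" "y * d = 0" using ind unfolding indep2_def by blast+
    then show "x = 0 \<and> y = 0" using nz by auto
  qed
  then have "\<not> collinear {A, B, C}" using indep2_iff_not_collinear by blast
  moreover have "indep2 (C - A) (D - A)"
    unfolding indep2_def
  proof (intro allI impI)
    fix x y assume "x *\<^sub>R (C - A) + y *\<^sub>R (D - A) = 0"
    then have "(x * b) *\<^sub>R (B - A) + (x * d + y) *\<^sub>R (D - A) = 0"
      unfolding CA by (simp add: scaleR_add_left scaleR_add_right add.assoc)
    then have "x * b = 0" "x * d + y = 0" using ind unfolding indep2_def by blast+
    then show "x = 0 \<and> y = 0" using nz by auto
  qed
  then have "\<not> collinear {A, C, D}" using indep2_iff_not_collinear by blast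
  moreover have "indep2 (C - B) (D - B)"
    unfolding indep2_def
  proof (intro allI impI)
    fix x y assume "x *\<^sub>R (C - B) + y *\<^sub>R (D - B) = 0"
    then have "(x * (b - 1) - y) *\<^sub>R (B - A) + (x * d + y) *\<^sub>R (D - A) = 0"
      unfolding C by (simp add: algebra_simps)
    then have e: "x * (b - 1) - y = 0" "x * d + y = 0" using ind unfolding indep2_def by blast+
    then have "x * (b + d - 1) = 0" by (simp add: algebra_simps)
    then have "x = 0" using nz by simp
    then show "x = 0 \<and> y = 0" using e by auto
  qed
  then have ncB: "\<not> collinear {B, C, D}" using indep2_iff_not_collinear by blast
  moreover have "distinct [A, B, C, D]"
    using calculation collinear_2 by (auto simp: insert_commute)
  moreover have "\<exists>p. p \<in> affine hull {A, C} \<and> p \<in> affine hull {B, D} \<and> p \<notin> {A, B, C, D}"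
  proof -
    \<comment> \<open>This multiple of \<open>C - A\<close> has coordinate sum one in the frame
      \<open>B - A\<close>, \<open>D - A\<close>, which places its endpoint on
      \<open>BD\<close>.\<close>
    define t where "t = 1 / (b + d)"
    define p where "p = A + t *\<^sub>R (C - A)"
    have pA: "p - A = (t * b) *\<^sub>R (B - A) + (t * d) *\<^sub>R (D - A)"
      unfolding p_def CA by (simp add: scaleR_add_right)
    have tt: "t * b + t * d = 1" unfolding t_def using nz by (simp add: add_divide_distrib[symmetric])
    have "p = (1 - t) *\<^sub>R A + t *\<^sub>R C" unfolding p_def by (simp add: algebra_simps)
    then have 1: "p \<in> affine hull {A, C}" unfolding affine_hull_2 by force
    have tb: "t * b = 1 - t * d" using tt by simp
    have "p = (t * b) *\<^sub>R B + (t * d) *\<^sub>R D"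
      using pA unfolding tb by (simp add: algebra_simps)
    then have 2: "p \<in> affine hull {B, D}" unfolding affine_hull_2 using tt by blast
    have "p \<noteq> A" "p \<noteq> C"
    proof -
      show "p \<noteq> A"
        using 2 \<open>\<not> collinear {A, B, D}\<close> affine_hull_3_imp_collinear by (metis insert_commute)
      show "p \<noteq> C"
        using 2 ncB affine_hull_3_imp_collinear by (metis insert_commute)
    qed
    moreover have "p \<noteq> B" "p \<noteq> D"
      using 1 \<open>\<not> collinear {A, B, C}\<close> \<open>\<not> collinear {A, C, D}\<close> affine_hull_3_imp_collinear
      by (metis insert_commute)+
    ultimately show ?thesis using 1 2 by blast
  qed
  ultimately show ?L unfolding nondeg_quad_def by blast
qed

section \<open>Flat connections on the lattice\<close>

lemma sh_simps [simp]:
  "sh 1 (x, y, z) = (x + 1, y, z)" "sh (Suc 0) (x, y, z) = (x + 1, y, z)"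
  "sh 2 (x, y, z) = (x, y + 1, z)" "sh 3 (x, y, z) = (x, y, z + 1)"
  by (simp_all add: sh_def latadd_def unitv_def)

lemma sh_commute: "sh i (sh j u) = sh j (sh i u)"
  by (simp add: sh_def latadd_def)

text \<open>With an equivalence as the step, one argument covers both directions of the integers. In
  the applications, injectivity of a transport map gives the equivalence.\<close>

lemma int_iff_step_induct:
  fixes P :: "int \<Rightarrow> bool"
  assumes "P 0" "\<And>k. P k \<longleftrightarrow> P (k + 1)"
  shows "P k"
proof (induction k rule: int_induct[where k = 0])
  case base
  then show ?case using assms(1) .
next
  case (step1 i)
  then show ?case using assms(2) by blast
next
  case (step2 i)
  then show ?case using assms(2)[of "i - 1"] by simp
qed

text \<open>Bijectivity allows the recursion to be run backwards as well, by applying the inverse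
  maps on the negative side.\<close>

lemma int_recursion_exists:
  fixes t :: "int \<Rightarrow> 'b \<Rightarrow> 'b"
  assumes "\<And>n. bij_betw (t n) X X" "x0 \<in> X"
  shows "\<exists>r. r 0 = x0 \<and> (\<forall>n. r n \<in> X \<and> r (n + 1) = t n (r n))"
proof -
  define P where "P = rec_nat x0 (\<lambda>m x. t (int m) x)"
  \<comment> \<open>\<open>Q m\<close> is the value at \<open>- int m\<close>. The map
    \<open>t (- int m - 1)\<close> leads from \<open>- int m - 1\<close> to \<open>- int m\<close>,
    so its inverse yields \<open>Q (Suc m)\<close>.\<close>
  define Q where "Q = rec_nat x0 (\<lambda>m x. inv_into X (t (- int m - 1)) x)"
  define r where "r n = (if n \<ge> 0 then P (nat n) else Q (nat (- n)))" for n
  have P: "P 0 = x0" "P (Suc m) = t (int m) (P m)" for m by (simp_all add: P_def)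
  have Q: "Q 0 = x0" "Q (Suc m) = inv_into X (t (- int m - 1)) (Q m)" for m by (simp_all add: Q_def)
  have PX: "P m \<in> X" for m
    by (induction m) (use P assms bij_betw_apply in \<open>metis+\<close>)
  have QX: "Q m \<in> X" for m
    by (induction m) (use Q assms in \<open>auto simp: bij_betw_def intro: inv_into_into\<close>)
  have tQ: "t (- int m - 1) (Q (Suc m)) = Q m" for m
    unfolding Q(2) by (rule bij_betw_inv_into_right[OF assms(1) QX])
  have "r n \<in> X \<and> r (n + 1) = t n (r n)" for n
  proof (cases "n \<ge> 0")
    case True
    then show ?thesis using PX P(2)[of "nat n"] by (simp add: r_def nat_add_distrib)
  next
    case False
    define m where "m = nat (- n - 1)"
    have n: "n = - int m - 1" using False by (simp add: m_def)
    have rn: "r n = Q (Suc m)" unfolding r_def n by (simp add: nat_add_distrib)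
    have "r (n + 1) = Q m" unfolding r_def n by (auto simp: P(1) Q(1))
    then show ?thesis using rn tQ QX n by metis
  qed
  moreover have "r 0 = x0" by (simp add: r_def P(1))
  ultimately show ?thesis by blast
qed

text \<open>The values are propagated along the first axis, then over a coordinate plane, then along
  all lines in direction 3. Flatness shows that the remaining step rules hold everywhere. It is
  applied to translations, which give the dual net, and to multiplications on the nonzero reals,
  which give the scaling factors; the latter is why a carrier \<open>X\<close> occurs.\<close>

lemma flat_transport_exists:
  fixes T :: "nat \<Rightarrow> lat \<Rightarrow> 'b \<Rightarrow> 'b"
  assumes bij: "\<And>i u. i \<in> dirs \<Longrightarrow> bij_betw (T i u) X X"
    and flat: "\<And>i j u x. i \<in> dirs \<Longrightarrow> j \<in> dirs \<Longrightarrow> i \<noteq> j \<Longrightarrow> x \<in> X \<Longrightarrow>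
      T i (sh j u) (T j u x) = T j (sh i u) (T i u x)"
    and "x0 \<in> X"
  shows "\<exists>\<rho>. \<forall>u. \<rho> u \<in> X \<and> (\<forall>i\<in>dirs. \<rho> (sh i u) = T i u (\<rho> u))"
proof -
  have d: "1 \<in> dirs" "2 \<in> dirs" "3 \<in> dirs" by (auto simp: dirs_def)
  have inj: "T i u x = T i u y \<longleftrightarrow> x = y" if "i \<in> dirs" "x \<in> X" "y \<in> X" for i u x y
    using bij[OF that(1), of u] that by (auto simp: bij_betw_def inj_on_def)
  have clo: "T i u x \<in> X" if "i \<in> dirs" "x \<in> X" for i u x
    using bij[OF that(1)] that(2) by (rule bij_betw_apply)
  obtain r1 where r1: "\<And>n. r1 n \<in> X" "\<And>n. r1 (n + 1) = T 1 (n, 0, 0) (r1 n)"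
    using int_recursion_exists[of "\<lambda>n. T 1 (n, 0, 0)", OF bij[OF d(1)] assms(3)] by blast
  have "\<forall>n. \<exists>r. r 0 = r1 n \<and> (\<forall>m. r m \<in> X \<and> r (m + 1) = T 2 (n, m, 0) (r m))"
    by (intro allI int_recursion_exists bij d r1(1))
  then obtain r2 where r2: "\<And>n. r2 n 0 = r1 n" "\<And>n m. r2 n m \<in> X"
      "\<And>n m. r2 n (m + 1) = T 2 (n, m, 0) (r2 n m)"
    by metis
  have "\<forall>n m. \<exists>r. r 0 = r2 n m \<and> (\<forall>k. r k \<in> X \<and> r (k + 1) = T 3 (n, m, k) (r k))"
    by (intro allI int_recursion_exists bij d r2(2))
  then obtain r3 where r3: "\<And>n m. r3 n m 0 = r2 n m" "\<And>n m k. r3 n m k \<in> X"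
      "\<And>n m k. r3 n m (k + 1) = T 3 (n, m, k) (r3 n m k)"
    by metis
  \<comment> \<open>By construction this rule holds only on the plane \<open>k = 0\<close>. Flatness
    carries it from \<open>k\<close> to \<open>k + 1\<close>, and injectivity of the transport in
    direction 3 carries it back.\<close>
  have s2: "r3 n (m + 1) k = T 2 (n, m, k) (r3 n m k)" for n m k
  proof (induction k rule: int_iff_step_induct)
    case 1
    show ?case by (simp add: r3(1) r2(3))
  next
    case (2 k)
    have "T 2 (n, m, k + 1) (r3 n m (k + 1)) = T 3 (n, m + 1, k) (T 2 (n, m, k) (r3 n m k))"
      using flat[OF d(2,3), of "r3 n m k" "(n, m, k)"] r3(2,3) by simp
    then show ?case
      using inj[OF d(3) r3(2) clo[OF d(2) r3(2)]] r3(3) by metis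
  qed
  have s1': "r2 (n + 1) m = T 1 (n, m, 0) (r2 n m)" for n m
  proof (induction m rule: int_iff_step_induct)
    case 1
    show ?case by (simp add: r2(1) r1(2))
  next
    case (2 m)
    have "T 1 (n, m + 1, 0) (r2 n (m + 1)) = T 2 (n + 1, m, 0) (T 1 (n, m, 0) (r2 n m))"
      using flat[OF d(1,2), of "r2 n m" "(n, m, 0)"] r2(2,3) by simp
    then show ?case
      using inj[OF d(2) r2(2) clo[OF d(1) r2(2)]] r2(3) by metis
  qed
  have s1: "r3 (n + 1) m k = T 1 (n, m, k) (r3 n m k)" for n m k
  proof (induction k rule: int_iff_step_induct)
    case 1
    show ?case by (simp add: r3(1) s1')
  next
    case (2 k)
    have "T 1 (n, m, k + 1) (r3 n m (k + 1)) = T 3 (n + 1, m, k) (T 1 (n, m, k) (r3 n m k))"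
      using flat[OF d(1,3), of "r3 n m k" "(n, m, k)"] r3(2,3) by simp
    then show ?case
      using inj[OF d(3) r3(2) clo[OF d(1) r3(2)]] r3(3) by metis
  qed
  define \<rho> where "\<rho> = (\<lambda>(n, m, k). r3 n m k)"
  have "\<rho> u \<in> X \<and> (\<forall>i\<in>dirs. \<rho> (sh i u) = T i u (\<rho> u))" for u
    using s1 s2 r3 by (cases u) (auto simp: \<rho>_def dirs_def)
  then show ?thesis by blast
qed

section \<open>Hexahedra\<close>

text \<open>The hypothesis \<^term>\<open>dirs = {i, j, k}\<close> says that \<open>(i, j, k)\<close> is a permutation of \<open>(1, 2, 3)\<close>.\<close>

lemma dirs_eqD:
  assumes "dirs = {i, j, k}"
  shows "i \<in> dirs" "j \<in> dirs" "k \<in> dirs" "i \<noteq> j" "i \<noteq> k" "j \<noteq> k"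
    "(i, j, k) \<in> {(1,2,3), (1,3,2), (2,1,3), (2,3,1), (3,1,2), (3,2,1)}"
proof -
  have "card {i, j, k} = 3" using assms by (simp add: dirs_def flip: assms)
  then show ne: "i \<noteq> j" "i \<noteq> k" "j \<noteq> k" by (auto simp: card_insert_if split: if_splits)
  show d: "i \<in> dirs" "j \<in> dirs" "k \<in> dirs" using assms by auto
  show "(i, j, k) \<in> {(1,2,3), (1,3,2), (2,1,3), (2,3,1), (3,1,2), (3,2,1)}"
    using d ne by (auto simp: dirs_def)
qed

lemma dirs_third:
  assumes "i \<in> dirs" "j \<in> dirs" "i \<noteq> j"
  obtains k where "dirs = {i, j, k}"
proof -
  \<comment> \<open>The three directions add up to 6.\<close>
  have "dirs = {i, j, 6 - i - j}" using assms by (auto simp: dirs_def)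
  then show thesis using that by blast
qed

lemma dirs_other:
  assumes "i \<in> dirs"
  obtains j where "j \<in> dirs" "i \<noteq> j"
  using that[of "if i = 1 then 2 else 1"] by (auto simp: dirs_def split: if_splits)

lemma dirs_123: "dirs = {1, 2, 3}" by (simp add: dirs_def)

section \<open>Scalar identities for a single hexahedron\<close>

text \<open>\<open>E1\<close>, \<open>E2\<close>, \<open>E3\<close> express the planarity of the
  three faces through f_123, and \<open>nc\<close> that f_12, f_23, f_13 are not collinear. If the
  sum is one, the right-hand sides vanish and every equation equates a term with the negative of
  another; multiplying the three leaves one sign, which is (K).\<close>

lemma hex_sum_one_iff:
  fixes a12 a21 a13 a31 a23 a32 x y z s12 s13 s23 :: real
  assumes nz: "a12 \<noteq> 0" "a21 \<noteq> 0" "a13 \<noteq> 0" "a31 \<noteq> 0" "a23 \<noteq> 0" "a32 \<noteq> 0"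
    and s: "s12 = 1 - a12 - a21" "s13 = 1 - a13 - a31" "s23 = 1 - a23 - a32"
    and snz: "s12 \<noteq> 0" "s13 \<noteq> 0" "s23 \<noteq> 0" and xnz: "x \<noteq> 0" "y \<noteq> 0" "z \<noteq> 0"
    and E1: "y / a21 * s12 + z / a31 * s13 = 1 - x - y - z"
    and E2: "x / a12 * s12 + z / a32 * s23 = 1 - x - y - z"
    and E3: "x / a13 * s13 + y / a23 * s23 = 1 - x - y - z"
    and nc: "a12 * a23 * a31 + a21 * a32 * a13 = 0 \<Longrightarrow> a23 / a21 + a32 / a31 \<noteq> 1"
  shows "a12 * a23 * a31 + a21 * a32 * a13 = 0 \<longleftrightarrow> x + y + z = 1"
proof
  assume K: "a12 * a23 * a31 + a21 * a32 * a13 = 0"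
  define \<alpha> \<beta> where "\<alpha> = a23 / a21" and "\<beta> = a32 / a31"
  have \<alpha>: "a23 = \<alpha> * a21" and \<beta>: "a32 = \<beta> * a31" using nz by (simp_all add: \<alpha>_def \<beta>_def)
  have "a21 * a31 * (\<alpha> * a12 + \<beta> * a13) = 0" using K unfolding \<alpha> \<beta> by (simp add: algebra_simps)
  then have ab: "\<alpha> * a12 + \<beta> * a13 = 0" using nz by simp
  have anz: "\<alpha> \<noteq> 0" "\<beta> \<noteq> 0" using nz by (auto simp: \<alpha>_def \<beta>_def)
  \<comment> \<open>\<open>(s23, - \<beta> * s13, - \<alpha> * s12)\<close> spans the left kernel of the matrix of the system; its coordinate sum
    vanishes only if \<open>\<alpha> + \<beta> = 1\<close>.\<close>
  let ?w = "s23 - \<beta> * s13 - \<alpha> * s12"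
  have "?w = 1 - \<alpha> - \<beta> + (\<alpha> * a12 + \<beta> * a13)"
    unfolding s \<alpha> \<beta> by (simp add: algebra_simps)
  then have w: "?w \<noteq> 0" using ab nc[OF K] by (simp add: \<alpha>_def \<beta>_def)
  \<comment> \<open>In this combination the terms in \<open>y\<close> and \<open>z\<close> cancel,
    and the coefficient of \<open>x\<close> contains the factor
    \<open>\<alpha> * a12 + \<beta> * a13\<close>, which is zero by (K).\<close>
  have "(1 - x - y - z) * ?w = s23 * (y / a21 * s12 + z / a31 * s13)
      - \<beta> * s13 * (x / a12 * s12 + z / a32 * s23) - \<alpha> * s12 * (x / a13 * s13 + y / a23 * s23)"
    unfolding E1 E2 E3 by (simp add: algebra_simps)
  also have "\<dots> = - s12 * s13 * x * (\<beta> / a12 + \<alpha> / a13)"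
    unfolding \<alpha> \<beta> using nz anz by (simp add: field_simps)
  also have "\<beta> / a12 + \<alpha> / a13 = (\<alpha> * a12 + \<beta> * a13) / (a12 * a13)"
    using nz by (simp add: field_simps)
  finally show "x + y + z = 1" using ab w by simp
next
  assume "x + y + z = 1"
  then have "1 - x - y - z = 0" by simp
  with E1 E2 E3 have "y / a21 * s12 = - (z / a31 * s13)" "z / a32 * s23 = - (x / a12 * s12)"
      "x / a13 * s13 = - (y / a23 * s23)"
    by linarith+
  then have "(y / a21 * s12) * (z / a32 * s23) * (x / a13 * s13) =
      (- (z / a31 * s13)) * (- (x / a12 * s12)) * (- (y / a23 * s23))"
    by simp
  then have "(x * y * z * s12 * s13 * s23) * (1 / (a21 * a32 * a13)) =
      (x * y * z * s12 * s13 * s23) * (- 1 / (a12 * a23 * a31))"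
    by (simp add: field_simps)
  then have "1 / (a21 * a32 * a13) = - 1 / (a12 * a23 * a31)"
    using xnz snz by (metis mult_cancel_left mult_eq_0_iff)
  then show "a12 * a23 * a31 + a21 * a32 * a13 = 0"
    using nz by (simp add: field_simps)
qed

text \<open>In terms of the net the conclusion reads a_12 s_13(u + e_2) + a_21 s_23(u + e_1) = 0,
  the identity behind the flatness of the scaling factors. Solving \<open>E1\<close> and
  \<open>E2\<close> for \<open>x\<close> and \<open>y\<close> and adding gives, by (K),
  \<open>s12 = z * (1 - a21 / a31 - a12 / a32)\<close>; with \<open>x + y = 1 - z\<close> this is
  the claim rearranged.\<close>

lemma hex_opposite_corner:
  fixes a12 a21 a13 a31 a23 a32 x y z s12 s13 s23 :: real
  assumes nz: "a12 \<noteq> 0" "a21 \<noteq> 0" "a13 \<noteq> 0" "a31 \<noteq> 0" "a23 \<noteq> 0" "a32 \<noteq> 0"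
    and s: "s12 = 1 - a12 - a21" "s13 = 1 - a13 - a31" "s23 = 1 - a23 - a32"
    and E1: "y / a21 * s12 + z / a31 * s13 = 0"
    and E2: "x / a12 * s12 + z / a32 * s23 = 0"
    and sum: "x + y + z = 1"
    and K: "a12 * a23 * a31 + a21 * a32 * a13 = 0"
  shows "a12 * (1 - x / a12 - z / a32) + a21 * (1 - y / a21 - z / a31) = 0"
proof -
  have "y * s12 = - z * (a21 * s13 / a31)" "x * s12 = - z * (a12 * s23 / a32)"
    using E1 E2 nz by (simp_all add: field_simps) 
  then have "(x + y) * s12 = - z * (a21 * s13 / a31 + a12 * s23 / a32)"
    by (simp add: algebra_simps)
  moreover have xy: "x + y = 1 - z" using sum by simp
  ultimately have "s12 = z * (s12 - a21 * s13 / a31 - a12 * s23 / a32)"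
    by (simp add: algebra_simps)
  also have "s12 - a21 * s13 / a31 - a12 * s23 / a32 =
      1 - a21 / a31 - a12 / a32 + (a12 * a23 * a31 + a21 * a32 * a13) / (a31 * a32)"
    unfolding s using nz by (simp add: field_simps)
  finally have "s12 = z * (1 - a21 / a31 - a12 / a32)" using K by simp
  then have "a12 + a21 = (x + y) + z * (a21 / a31 + a12 / a32)"
    unfolding s xy by (simp add: algebra_simps)
  then show ?thesis using nz by (simp add: algebra_simps)
qed

section \<open>Face coefficients and the coplanarity conditions\<close>

locale nondeg_qnet =
  fixes f :: "lat \<Rightarrow> 'a::euclidean_space"
  assumes qnet: "qnet f" and hex: "\<And>u. nondeg_hex f u"
begin

definition \<delta> :: "nat \<Rightarrow> lat \<Rightarrow> 'a" where
  "\<delta> i u = f (sh i u) - f u"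

text \<open>The coefficient a_ij of the diagonal f_ij - f. The choice is unique because the two edge
  vectors are independent, see \<open>face_expansion\<close>.\<close>

definition a :: "nat \<Rightarrow> nat \<Rightarrow> lat \<Rightarrow> real" where
  "a i j u = (SOME b. \<exists>d. f (sh j (sh i u)) - f u = b *\<^sub>R \<delta> i u + d *\<^sub>R \<delta> j u)"

text \<open>Its reciprocal is the factor in the shift rule for dual edges. The value 0 would put
  f_ij on the line through f_i and f_j, and the value 1 would make the diagonals parallel.\<close>

definition s :: "nat \<Rightarrow> nat \<Rightarrow> lat \<Rightarrow> real" where
  "s i j u = 1 - a i j u - a j i u"

definition K :: "lat \<Rightarrow> bool" where
  "K u \<longleftrightarrow> a 1 2 u * a 2 3 u * a 3 1 u + a 2 1 u * a 3 2 u * a 1 3 u = 0"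

lemma face_expansion:
  assumes "i \<in> dirs" "j \<in> dirs" "i \<noteq> j"
  shows "indep2 (\<delta> i u) (\<delta> j u)"
    and "f (sh j (sh i u)) - f u = a i j u *\<^sub>R \<delta> i u + a j i u *\<^sub>R \<delta> j u"
    and "a i j u \<noteq> 0" "s i j u \<noteq> 0" "s i j u \<noteq> 1"
proof -
  have Q: "indep2 (\<delta> i u) (\<delta> j u) \<and>
    (\<exists>b d. f (sh j (sh i u)) - f u = b *\<^sub>R \<delta> i u + d *\<^sub>R \<delta> j u \<and>
       b \<noteq> 0 \<and> d \<noteq> 0 \<and> b + d \<noteq> 0 \<and> b + d \<noteq> 1)"
    using qnet assms unfolding qnet_def quad_iff_coefficients \<delta>_def by blast
  then obtain b d where ind: "indep2 (\<delta> i u) (\<delta> j u)"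
    and fij: "f (sh j (sh i u)) - f u = b *\<^sub>R \<delta> i u + d *\<^sub>R \<delta> j u"
    and nz: "b \<noteq> 0" "d \<noteq> 0" "b + d \<noteq> 0" "b + d \<noteq> 1" by blast
  have fji: "f (sh i (sh j u)) - f u = d *\<^sub>R \<delta> j u + b *\<^sub>R \<delta> i u"
    using fij by (simp add: sh_commute[of i j] add.commute)
  have "a i j u = b"
    unfolding a_def
  proof (rule some_equality)
    show "\<exists>d. f (sh j (sh i u)) - f u = b *\<^sub>R \<delta> i u + d *\<^sub>R \<delta> j u" using fij by blast
  qed (use indep2D[OF ind] fij in metis)
  moreover have "a j i u = d"
    unfolding a_def
  proof (rule some_equality)
    show "\<exists>b. f (sh i (sh j u)) - f u = d *\<^sub>R \<delta> j u + b *\<^sub>R \<delta> i u" using fji by blast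
  qed (use indep2D[OF indep2_commute[OF ind]] fji in metis)
  ultimately show "indep2 (\<delta> i u) (\<delta> j u)"
    "f (sh j (sh i u)) - f u = a i j u *\<^sub>R \<delta> i u + a j i u *\<^sub>R \<delta> j u"
    "a i j u \<noteq> 0" "s i j u \<noteq> 0" "s i j u \<noteq> 1"
    using ind fij nz unfolding s_def by auto
qed

lemma \<delta>_shift:
  assumes "i \<in> dirs" "j \<in> dirs" "i \<noteq> j"
  shows "\<delta> j (sh i u) = (a i j u - 1) *\<^sub>R \<delta> i u + a j i u *\<^sub>R \<delta> j u"
  using face_expansion(2)[OF assms, of u] unfolding \<delta>_def by (simp add: algebra_simps)

lemma indep_\<delta>:
  assumes "dirs = {i, j, k}"
  shows "indep3 (\<delta> i u) (\<delta> j u) (\<delta> k u)"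
proof -
  have "{f u, f (sh i u), f (sh j u), f (sh k u)} = insert (f u) ((\<lambda>i. f (sh i u)) ` dirs)"
    unfolding assms by auto
  also have "\<dots> = {f u, f (sh 1 u), f (sh 2 u), f (sh 3 u)}"
    unfolding dirs_def by auto
  finally have "aff_dim {f u, f (sh i u), f (sh j u), f (sh k u)} = 3"
    using hex[of u] unfolding nondeg_hex_def by simp
  then show ?thesis unfolding \<delta>_def by (rule indep3_if_aff_dim)
qed

text \<open>Cyclic permutations fix each of the two products, and transpositions exchange
  them.\<close>

lemma K_perm:
  assumes "dirs = {i, j, k}"
  shows "K u \<longleftrightarrow> a i j u * a j k u * a k i u + a j i u * a k j u * a i k u = 0"
  using dirs_eqD(7)[OF assms] unfolding K_def by (auto simp: algebra_simps)

lemma coplanar_even_iff: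
  "coplanar {f u, f (sh 2 (sh 1 u)), f (sh 3 (sh 2 u)), f (sh 3 (sh 1 u))} \<longleftrightarrow> K u"
proof -
  have d: "1 \<in> dirs" "2 \<in> dirs" "3 \<in> dirs" "(1::nat) \<noteq> 2" "(1::nat) \<noteq> 3" "(2::nat) \<noteq> 3"
    by (auto simp: dirs_def)
  let ?v = "a 1 2 u *\<^sub>R \<delta> 1 u + a 2 1 u *\<^sub>R \<delta> 2 u"
  let ?w = "a 2 3 u *\<^sub>R \<delta> 2 u + a 3 2 u *\<^sub>R \<delta> 3 u"
  let ?t = "a 1 3 u *\<^sub>R \<delta> 1 u + a 3 1 u *\<^sub>R \<delta> 3 u"
  have nz: "a 1 2 u \<noteq> 0" "a 1 3 u \<noteq> 0" "a 2 3 u \<noteq> 0" "a 2 1 u \<noteq> 0" "a 3 1 u \<noteq> 0" "a 3 2 u \<noteq> 0"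
    using face_expansion(3) d by metis+
  have comb: "x *\<^sub>R ?v + y *\<^sub>R ?w + z *\<^sub>R ?t = (x * a 1 2 u + z * a 1 3 u) *\<^sub>R \<delta> 1 u
      + (x * a 2 1 u + y * a 2 3 u) *\<^sub>R \<delta> 2 u + (y * a 3 2 u + z * a 3 1 u) *\<^sub>R \<delta> 3 u" for x y z
    by (simp add: algebra_simps)
  have "\<not> indep3 ?v ?w ?t \<longleftrightarrow> K u"
  proof
    assume "K u"
    then have K: "a 1 2 u * a 2 3 u * a 3 1 u = - (a 2 1 u * a 3 2 u * a 1 3 u)"
      unfolding K_def by linarith
    \<comment> \<open>The last two coefficients are chosen to cancel \<open>\<delta> 2 u\<close> and
      \<open>\<delta> 1 u\<close>; that \<open>\<delta> 3 u\<close> then cancels too is (K).\<close>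
    have "1 *\<^sub>R ?v + (- a 2 1 u / a 2 3 u) *\<^sub>R ?w + (- a 1 2 u / a 1 3 u) *\<^sub>R ?t = 0"
      unfolding comb using nz K by (simp add: field_simps)
    then show "\<not> indep3 ?v ?w ?t" unfolding indep3_def by (metis zero_neq_one)
  next
    assume "\<not> indep3 ?v ?w ?t"
    then obtain x y z where "x *\<^sub>R ?v + y *\<^sub>R ?w + z *\<^sub>R ?t = 0" and xyz: "x \<noteq> 0 \<or> y \<noteq> 0 \<or> z \<noteq> 0"
      unfolding indep3_def by blast
    then have e: "x * a 1 2 u = - z * a 1 3 u" "y * a 2 3 u = - x * a 2 1 u"
        "z * a 3 1 u = - y * a 3 2 u"
      using indep_\<delta>[OF dirs_123, of u] unfolding comb indep3_def by fastforce+
    \<comment> \<open>Each relation ties two of the unknowns together by nonzero factors, so one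
      nonzero unknown makes all of them nonzero.\<close>
    then have nz': "x \<noteq> 0" "y \<noteq> 0" "z \<noteq> 0" using xyz nz by auto
    have "(x * a 1 2 u) * (y * a 2 3 u) * (z * a 3 1 u) =
        (- z * a 1 3 u) * (- x * a 2 1 u) * (- y * a 3 2 u)"
      unfolding e by simp
    then have "(x * y * z) * (a 1 2 u * a 2 3 u * a 3 1 u + a 2 1 u * a 3 2 u * a 1 3 u) = 0"
      by (simp add: algebra_simps)
    then show "K u" using nz' unfolding K_def by simp
  qed
  then show ?thesis
    unfolding coplanar_4_iff using face_expansion(2)[OF d(1,2,4), of u] face_expansion(2)[OF d(2,3,6), of u]
      face_expansion(2)[OF d(1,3,5), of u] by simp
qed

text \<open>For each direction i, f_123 is expanded in the face at f_i opposite to f, and the edges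
  of that face are rewritten in the frame at \<open>u\<close>. Comparing coordinates, the
  \<open>\<delta> j u\<close> part gives the shifted face coefficient and the
  \<open>\<delta> i u\<close> part gives the linear equation. \<open>F\<close> is indexed by
  directions so that all permutations are covered at once.\<close>

lemma hex_coordinates:
  obtains F where
    "f (sh 3 (sh 2 (sh 1 u))) - f u = F 1 *\<^sub>R \<delta> 1 u + F 2 *\<^sub>R \<delta> 2 u + F 3 *\<^sub>R \<delta> 3 u"
    "\<And>i j k. dirs = {i, j, k} \<Longrightarrow> a j k (sh i u) = F j / a j i u"
    "\<And>i j k. dirs = {i, j, k} \<Longrightarrow>
      F j / a j i u * s i j u + F k / a k i u * s i k u = 1 - F 1 - F 2 - F 3"
    "\<And>i. i \<in> dirs \<Longrightarrow> F i \<noteq> 0"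
proof -
  have expand: "f (sh k (sh j (sh i u))) - f u =
      (1 + a j k (sh i u) * (a i j u - 1) + a k j (sh i u) * (a i k u - 1)) *\<^sub>R \<delta> i u
      + (a j k (sh i u) * a j i u) *\<^sub>R \<delta> j u + (a k j (sh i u) * a k i u) *\<^sub>R \<delta> k u"
    if p: "dirs = {i, j, k}" for i j k
  proof -
    note d = dirs_eqD(1-6)[OF p]
    have "f (sh k (sh j (sh i u))) - f u = \<delta> i u + (a j k (sh i u) *\<^sub>R \<delta> j (sh i u) + a k j (sh i u) *\<^sub>R \<delta> k (sh i u))"
      using face_expansion(2)[OF d(2,3,6), of "sh i u"] by (simp add: \<delta>_def[of i u] algebra_simps)
    also have "\<dots> = \<delta> i u + (a j k (sh i u) *\<^sub>R ((a i j u - 1) *\<^sub>R \<delta> i u + a j i u *\<^sub>R \<delta> j u)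
        + a k j (sh i u) *\<^sub>R ((a i k u - 1) *\<^sub>R \<delta> i u + a k i u *\<^sub>R \<delta> k u))"
      unfolding \<delta>_shift[OF d(1,2,4)] \<delta>_shift[OF d(1,3,5)] ..
    finally show ?thesis by (simp add: algebra_simps)
  qed
  have "\<exists>F::nat \<Rightarrow> real. f (sh 3 (sh 2 (sh 1 u))) - f u = F 1 *\<^sub>R \<delta> 1 u + F 2 *\<^sub>R \<delta> 2 u + F 3 *\<^sub>R \<delta> 3 u"
  proof -
    have "\<exists>x y z::real. f (sh 3 (sh 2 (sh 1 u))) - f u = x *\<^sub>R \<delta> 1 u + y *\<^sub>R \<delta> 2 u + z *\<^sub>R \<delta> 3 u"
      using expand[OF dirs_123] by blast
    then obtain x y z :: real where "f (sh 3 (sh 2 (sh 1 u))) - f u = x *\<^sub>R \<delta> 1 u + y *\<^sub>R \<delta> 2 u + z *\<^sub>R \<delta> 3 u"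
      by blast
    then show ?thesis
      by (intro exI[of _ "\<lambda>i. if i = 1 then x else if i = 2 then y else z"]) simp
  qed
  then obtain F :: "nat \<Rightarrow> real" where
    F: "f (sh 3 (sh 2 (sh 1 u))) - f u = F 1 *\<^sub>R \<delta> 1 u + F 2 *\<^sub>R \<delta> 2 u + F 3 *\<^sub>R \<delta> 3 u" by blast
  have eqs: "F i = 1 + a j k (sh i u) * (a i j u - 1) + a k j (sh i u) * (a i k u - 1)"
      "F j = a j k (sh i u) * a j i u" "F k = a k j (sh i u) * a k i u"
      "F i + F j + F k = F 1 + F 2 + F 3"
    if p: "dirs = {i, j, k}" for i j k
  proof -
    have "sh k (sh j (sh i u)) = sh 3 (sh 2 (sh 1 u))"
      using dirs_eqD(7)[OF p] by (cases u) auto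
    moreover have "F 1 *\<^sub>R \<delta> 1 u + F 2 *\<^sub>R \<delta> 2 u + F 3 *\<^sub>R \<delta> 3 u = F i *\<^sub>R \<delta> i u + F j *\<^sub>R \<delta> j u + F k *\<^sub>R \<delta> k u"
      using dirs_eqD(7)[OF p] by (auto simp: algebra_simps)
    ultimately have eq: "F i *\<^sub>R \<delta> i u + F j *\<^sub>R \<delta> j u + F k *\<^sub>R \<delta> k u =
      (1 + a j k (sh i u) * (a i j u - 1) + a k j (sh i u) * (a i k u - 1)) *\<^sub>R \<delta> i u
      + (a j k (sh i u) * a j i u) *\<^sub>R \<delta> j u + (a k j (sh i u) * a k i u) *\<^sub>R \<delta> k u"
      using expand[OF p] F by simp
    show "F i = 1 + a j k (sh i u) * (a i j u - 1) + a k j (sh i u) * (a i k u - 1)"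
      "F j = a j k (sh i u) * a j i u" "F k = a k j (sh i u) * a k i u"
      by (rule indep3D[OF indep_\<delta>[OF p] eq])+
    show "F i + F j + F k = F 1 + F 2 + F 3" using dirs_eqD(7)[OF p] by auto
  qed
  have A: "a j k (sh i u) = F j / a j i u" if p: "dirs = {i, j, k}" for i j k
    using eqs(2)[OF p] face_expansion(3) dirs_eqD[OF p] by simp
  have E: "F j / a j i u * s i j u + F k / a k i u * s i k u = 1 - F 1 - F 2 - F 3"
    if p: "dirs = {i, j, k}" for i j k
  proof -
    have p': "dirs = {i, k, j}" using p by auto
    have "F j / a j i u * s i j u + F k / a k i u * s i k u
      = a j k (sh i u) * s i j u + a k j (sh i u) * s i k u"
      unfolding A[OF p] A[OF p'] ..
    also have "\<dots> = 1 - (F i + F j + F k)"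
      unfolding eqs(1-3)[OF p] s_def by (simp add: algebra_simps)
    finally show ?thesis unfolding eqs(4)[OF p] by simp
  qed
  have "F i \<noteq> 0" if "i \<in> dirs" for i
  proof -
    obtain j where "j \<in> dirs" "i \<noteq> j" using dirs_other[OF \<open>i \<in> dirs\<close>] .
    then obtain k where p: "dirs = {j, i, k}" using dirs_third \<open>i \<in> dirs\<close> by metis
    show ?thesis using eqs(2)[OF p] face_expansion(3) dirs_eqD[OF p] by simp
  qed
  then show thesis using that F A E by blast
qed

lemma coplanar_odd_iff:
  assumes "f (sh 3 (sh 2 (sh 1 u))) - f u = x *\<^sub>R \<delta> 1 u + y *\<^sub>R \<delta> 2 u + z *\<^sub>R \<delta> 3 u"
  shows "coplanar {f (sh 1 u), f (sh 2 u), f (sh 3 u), f (sh 3 (sh 2 (sh 1 u)))} \<longleftrightarrow> x + y + z = 1"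
proof -
  let ?t = "(x - 1) *\<^sub>R \<delta> 1 u + y *\<^sub>R \<delta> 2 u + z *\<^sub>R \<delta> 3 u"
  have eq: "f (sh 2 u) - f (sh 1 u) = \<delta> 2 u - \<delta> 1 u" "f (sh 3 u) - f (sh 1 u) = \<delta> 3 u - \<delta> 1 u"
    "f (sh 3 (sh 2 (sh 1 u))) - f (sh 1 u) = ?t"
  proof -
    have "f (sh 3 (sh 2 (sh 1 u))) - f (sh 1 u) = (f (sh 3 (sh 2 (sh 1 u))) - f u) - \<delta> 1 u"
      by (simp add: \<delta>_def)
    then show "f (sh 3 (sh 2 (sh 1 u))) - f (sh 1 u) = ?t"
      unfolding assms by (simp add: algebra_simps)
  qed (simp_all add: \<delta>_def)
  have comb: "p *\<^sub>R (\<delta> 2 u - \<delta> 1 u) + q *\<^sub>R (\<delta> 3 u - \<delta> 1 u) + r *\<^sub>R ?t =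
      (r * (x - 1) - p - q) *\<^sub>R \<delta> 1 u + (p + r * y) *\<^sub>R \<delta> 2 u + (q + r * z) *\<^sub>R \<delta> 3 u" for p q r
    by (simp add: algebra_simps)
  have "\<not> indep3 (\<delta> 2 u - \<delta> 1 u) (\<delta> 3 u - \<delta> 1 u) ?t \<longleftrightarrow> x + y + z = 1"
  proof
    assume "x + y + z = 1"
    then have "1 * (x - 1) - (- y) - (- z) = 0" by simp
    then have "(- y) *\<^sub>R (\<delta> 2 u - \<delta> 1 u) + (- z) *\<^sub>R (\<delta> 3 u - \<delta> 1 u) + 1 *\<^sub>R ?t = 0"
      unfolding comb by simp
    then show "\<not> indep3 (\<delta> 2 u - \<delta> 1 u) (\<delta> 3 u - \<delta> 1 u) ?t" unfolding indep3_def by (metis zero_neq_one)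
  next
    assume "\<not> indep3 (\<delta> 2 u - \<delta> 1 u) (\<delta> 3 u - \<delta> 1 u) ?t"
    then obtain p q r where "p *\<^sub>R (\<delta> 2 u - \<delta> 1 u) + q *\<^sub>R (\<delta> 3 u - \<delta> 1 u) + r *\<^sub>R ?t = 0"
        and nz: "p \<noteq> 0 \<or> q \<noteq> 0 \<or> r \<noteq> 0"
      unfolding indep3_def by blast
    then have e: "r * (x - 1) - p - q = 0" "p + r * y = 0" "q + r * z = 0"
      using indep_\<delta>[OF dirs_123, of u] unfolding comb indep3_def by fastforce+
    then have "r \<noteq> 0" using nz by auto
    moreover have "r * (x + y + z - 1) = 0" using e by (simp add: algebra_simps)
    ultimately show "x + y + z = 1" by simp
  qed
  then show ?thesis unfolding coplanar_4_iff eq .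
qed

text \<open>Under (K) the vector f_23 - f is a combination of f_12 - f and f_13 - f with exactly
  these two coefficients. If they added up to one, f_12, f_23, f_13 would be collinear, against
  \<open>nondeg_hex\<close>.\<close>

lemma noncollinear_even:
  assumes "K u"
  shows "a 2 3 u / a 2 1 u + a 3 2 u / a 3 1 u \<noteq> 1"
proof
  assume one: "a 2 3 u / a 2 1 u + a 3 2 u / a 3 1 u = 1"
  define \<alpha> \<beta> where "\<alpha> = a 2 3 u / a 2 1 u" and "\<beta> = a 3 2 u / a 3 1 u"
  have d: "1 \<in> dirs" "2 \<in> dirs" "3 \<in> dirs" "(1::nat) \<noteq> 2" "(1::nat) \<noteq> 3" "(2::nat) \<noteq> 3"
    by (auto simp: dirs_def)
  have nz: "a 1 2 u \<noteq> 0" "a 1 3 u \<noteq> 0" "a 2 3 u \<noteq> 0" "a 2 1 u \<noteq> 0" "a 3 1 u \<noteq> 0" "a 3 2 u \<noteq> 0"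
    using face_expansion(3) d by metis+
  have \<alpha>: "a 2 3 u = \<alpha> * a 2 1 u" and \<beta>: "a 3 2 u = \<beta> * a 3 1 u"
    using nz by (simp_all add: \<alpha>_def \<beta>_def)
  have "a 2 1 u * a 3 1 u * (\<alpha> * a 1 2 u + \<beta> * a 1 3 u) = 0"
    using assms unfolding K_def \<alpha> \<beta> by (simp add: algebra_simps)
  then have ab: "\<alpha> * a 1 2 u + \<beta> * a 1 3 u = 0" using nz by simp
  have "\<alpha> *\<^sub>R (f (sh 2 (sh 1 u)) - f u) + \<beta> *\<^sub>R (f (sh 3 (sh 1 u)) - f u) =
      (\<alpha> * a 1 2 u + \<beta> * a 1 3 u) *\<^sub>R \<delta> 1 u + ((\<alpha> * a 2 1 u) *\<^sub>R \<delta> 2 u + (\<beta> * a 3 1 u) *\<^sub>R \<delta> 3 u)"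
    unfolding face_expansion(2)[OF d(1,2,4)] face_expansion(2)[OF d(1,3,5)] by (simp add: algebra_simps)
  also have "\<dots> = f (sh 3 (sh 2 u)) - f u"
    unfolding face_expansion(2)[OF d(2,3,6)] \<alpha>[symmetric] \<beta>[symmetric] ab by simp
  finally have e: "f (sh 3 (sh 2 u)) - f u =
    \<alpha> *\<^sub>R (f (sh 2 (sh 1 u)) - f u) + \<beta> *\<^sub>R (f (sh 3 (sh 1 u)) - f u)" ..
  have \<alpha>1: "\<alpha> = 1 - \<beta>" using one by (simp add: \<alpha>_def \<beta>_def)
  have "1 *\<^sub>R (f (sh 3 (sh 2 u)) - f (sh 2 (sh 1 u))) + (- \<beta>) *\<^sub>R (f (sh 3 (sh 1 u)) - f (sh 2 (sh 1 u))) = 0"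
    using e unfolding \<alpha>1 by (simp add: algebra_simps)
  then have "\<not> indep2 (f (sh 3 (sh 2 u)) - f (sh 2 (sh 1 u))) (f (sh 3 (sh 1 u)) - f (sh 2 (sh 1 u)))"
    unfolding indep2_def by (metis zero_neq_one)
  then have col: "collinear {f (sh 2 (sh 1 u)), f (sh 3 (sh 2 u)), f (sh 3 (sh 1 u))}"
    using indep2_iff_not_collinear by blast
  let ?xs = "[f u, f (sh 1 u), f (sh 2 u), f (sh 3 u),
     f (sh 2 (sh 1 u)), f (sh 3 (sh 2 u)), f (sh 3 (sh 1 u)), f (sh 3 (sh 2 (sh 1 u)))]"
  have "card (set ?xs) = length ?xs"
    using hex[of u] unfolding nondeg_hex_def hex_vertices_def by (simp only: list.set) simp
  then have "distinct ?xs" by (rule card_distinct)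
  then have "distinct [f (sh 2 (sh 1 u)), f (sh 3 (sh 2 u)), f (sh 3 (sh 1 u))]"
    by simp
  moreover have "f (sh 2 (sh 1 u)) \<in> hex_vertices f u" "f (sh 3 (sh 2 u)) \<in> hex_vertices f u"
    "f (sh 3 (sh 1 u)) \<in> hex_vertices f u"
    unfolding hex_vertices_def by blast+
  ultimately show False using col hex[of u] unfolding nondeg_hex_def by blast
qed

lemma K_iff_sum:
  assumes A: "\<And>i. i \<in> dirs \<Longrightarrow> F i \<noteq> 0"
    and E: "\<And>i j k. dirs = {i, j, k} \<Longrightarrow>
      F j / a j i u * s i j u + F k / a k i u * s i k u = 1 - F 1 - F 2 - F 3"
  shows "K u \<longleftrightarrow> F 1 + F 2 + F 3 = 1"
proof -
  have d: "1 \<in> dirs" "2 \<in> dirs" "3 \<in> dirs" "(1::nat) \<noteq> 2" "(1::nat) \<noteq> 3" "(2::nat) \<noteq> 3"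
    by (auto simp: dirs_def)
  have nz: "a 1 2 u \<noteq> 0" "a 2 1 u \<noteq> 0" "a 1 3 u \<noteq> 0" "a 3 1 u \<noteq> 0" "a 2 3 u \<noteq> 0" "a 3 2 u \<noteq> 0"
    using face_expansion(3) d by metis+
  have "s 2 1 u = s 1 2 u" "s 3 1 u = s 1 3 u" "s 3 2 u = s 2 3 u" by (simp_all add: s_def)
  then have e2: "F 1 / a 1 2 u * s 1 2 u + F 3 / a 3 2 u * s 2 3 u = 1 - F 1 - F 2 - F 3"
    and e3: "F 1 / a 1 3 u * s 1 3 u + F 2 / a 2 3 u * s 2 3 u = 1 - F 1 - F 2 - F 3"
    using E[of 2 1 3] E[of 3 1 2] by (auto simp: dirs_def)
  show ?thesis
    unfolding K_def
    by (rule hex_sum_one_iff[OF nz s_def s_def s_def face_expansion(4)[OF d(1,2,4)] face_expansion(4)[OF d(1,3,5)]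
          face_expansion(4)[OF d(2,3,6)] A[OF d(1)] A[OF d(2)] A[OF d(3)] E[OF dirs_123] e2 e3
          noncollinear_even[unfolded K_def]])
qed

theorem coplanar_even_iff_odd:
  "coplanar {f u, f (sh 2 (sh 1 u)), f (sh 3 (sh 2 u)), f (sh 3 (sh 1 u))} \<longleftrightarrow>
   coplanar {f (sh 1 u), f (sh 2 u), f (sh 3 u), f (sh 3 (sh 2 (sh 1 u)))}"
proof -
  obtain F where F: "f (sh 3 (sh 2 (sh 1 u))) - f u = F 1 *\<^sub>R \<delta> 1 u + F 2 *\<^sub>R \<delta> 2 u + F 3 *\<^sub>R \<delta> 3 u"
    "\<And>i j k. dirs = {i, j, k} \<Longrightarrow>
      F j / a j i u * s i j u + F k / a k i u * s i k u = 1 - F 1 - F 2 - F 3"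
    "\<And>i. i \<in> dirs \<Longrightarrow> F i \<noteq> 0"
    using hex_coordinates by metis
  show ?thesis
    unfolding coplanar_even_iff coplanar_odd_iff[OF F(1)] using K_iff_sum F(2,3) by blast
qed

section \<open>Dual nets\<close>

lemma koenigs_imp_K:
  assumes "koenigs f"
  shows "K u"
proof -
  obtain fs :: "lat \<Rightarrow> 'a" where fs: "qnet fs" and
    dual: "\<And>u i j. i \<in> dirs \<Longrightarrow> j \<in> dirs \<Longrightarrow> i \<noteq> j \<Longrightarrow>
        dual_quad (f u) (f (sh i u)) (f (sh j (sh i u))) (f (sh j u))
                  (fs u) (fs (sh i u)) (fs (sh j (sh i u))) (fs (sh j u))"
    using assms unfolding koenigs_def by blast
  have "\<exists>c. c \<noteq> 0 \<and> fs (sh i u) - fs u = c *\<^sub>R \<delta> i u" if i: "i \<in> dirs" for i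
  proof -
    obtain j where j: "j \<in> dirs" "i \<noteq> j" using dirs_other[OF i] .
    \<comment> \<open>\<open>parallel\<close> holds trivially for a zero vector, so nondegeneracy is
      applied to both nets to obtain a nonzero factor.\<close>
    have "h (sh i u) - h u \<noteq> 0" if "qnet h" for h :: "lat \<Rightarrow> 'a"
    proof -
      have "nondeg_quad (h u) (h (sh i u)) (h (sh j (sh i u))) (h (sh j u))"
        using that i j unfolding qnet_def by blast
      then show ?thesis unfolding nondeg_quad_def by auto
    qed
    then have "fs (sh i u) - fs u \<noteq> 0" "\<delta> i u \<noteq> 0"
      using fs qnet unfolding \<delta>_def by blast+
    have "parallel (fs (sh i u) - fs u) (\<delta> i u)"
      using dual[OF i j] unfolding dual_quad_def \<delta>_def by blast
    then consider c where "fs (sh i u) - fs u = c *\<^sub>R \<delta> i u" | c where "\<delta> i u = c *\<^sub>R (fs (sh i u) - fs u)"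
      unfolding parallel_def by blast
    then show ?thesis
    proof cases
      case (1 c)
      then show ?thesis using \<open>fs (sh i u) - fs u \<noteq> 0\<close> by (metis scaleR_zero_left)
    next
      case (2 c)
      then have "c \<noteq> 0" using \<open>\<delta> i u \<noteq> 0\<close> by auto
      then have "fs (sh i u) - fs u = (1 / c) *\<^sub>R \<delta> i u" "1 / c \<noteq> 0" using 2 by auto
      then show ?thesis by blast
    qed
  qed
  then obtain c where c: "\<And>i. i \<in> dirs \<Longrightarrow> c i \<noteq> 0"
      "\<And>i. i \<in> dirs \<Longrightarrow> fs (sh i u) - fs u = c i *\<^sub>R \<delta> i u"
    by metis
  have ratio: "c i * a j i u = - (c j * a i j u)" if ij: "i \<in> dirs" "j \<in> dirs" "i \<noteq> j" for i j
  proof -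
    have "fs (sh j u) - fs (sh i u) = (fs (sh j u) - fs u) - (fs (sh i u) - fs u)" by simp
    then have e: "fs (sh j u) - fs (sh i u) = (- c i) *\<^sub>R \<delta> i u + c j *\<^sub>R \<delta> j u"
      unfolding c(2)[OF ij(1)] c(2)[OF ij(2)] by simp
    have "parallel (fs (sh j u) - fs (sh i u)) (f (sh j (sh i u)) - f u)"
      using dual[OF ij] unfolding dual_quad_def by blast
    then consider t where "(- c i) *\<^sub>R \<delta> i u + c j *\<^sub>R \<delta> j u = (t * a i j u) *\<^sub>R \<delta> i u + (t * a j i u) *\<^sub>R \<delta> j u"
      | t where "a i j u *\<^sub>R \<delta> i u + a j i u *\<^sub>R \<delta> j u = (t * - c i) *\<^sub>R \<delta> i u + (t * c j) *\<^sub>R \<delta> j u"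
      unfolding parallel_def e face_expansion(2)[OF ij] scaleR_add_right scaleR_scaleR by blast
    then show ?thesis
    proof cases
      case (1 t)
      then have "- c i = t * a i j u" and cj: "c j = t * a j i u"
        using indep2D[OF face_expansion(1)[OF ij]] by blast+
      then have ci: "c i = - (t * a i j u)" by linarith
      show ?thesis unfolding ci cj by simp
    next
      case (2 t)
      then have "a i j u = t * - c i" "a j i u = t * c j" using indep2D[OF face_expansion(1)[OF ij]] by blast+
      then show ?thesis by simp
    qed
  qed
  have d: "1 \<in> dirs" "2 \<in> dirs" "3 \<in> dirs" "(1::nat) \<noteq> 2" "(3::nat) \<noteq> 1" "(2::nat) \<noteq> 3"
    by (auto simp: dirs_def)
  \<comment> \<open>The ratios are multiplied around the vertex f: the factors \<open>c\<close>
    agree on both sides and three signs remain.\<close>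
  have "(c 1 * a 2 1 u) * (c 2 * a 3 2 u) * (c 3 * a 1 3 u) =
      (- (c 2 * a 1 2 u)) * (- (c 3 * a 2 3 u)) * (- (c 1 * a 3 1 u))"
    unfolding ratio[OF d(1,2,4)] ratio[OF d(2,3,6)] ratio[OF d(3,1,5)] ..
  then have "c 1 * c 2 * c 3 * (a 1 2 u * a 2 3 u * a 3 1 u + a 2 1 u * a 3 2 u * a 1 3 u) = 0"
    by (simp add: algebra_simps)
  then show ?thesis using c(1) d unfolding K_def by simp
qed

text \<open>Reduces duality to scalar conditions on edge factors. By \<open>shift\<close>, the path
  around either side of a face adds up to a multiple of the diagonal f_j - f_i, and by
  \<open>ratio\<close> the two multiples agree. So the edge vectors close up, and one pair of
  diagonals is already parallel.\<close>

lemma dual_net_of_coefficients: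
  assumes nz: "\<And>i u. i \<in> dirs \<Longrightarrow> c i u \<noteq> 0"
    and ratio: "\<And>i j u. i \<in> dirs \<Longrightarrow> j \<in> dirs \<Longrightarrow> i \<noteq> j \<Longrightarrow> c i u * a j i u = - (c j u * a i j u)"
    and shift: "\<And>i j u. i \<in> dirs \<Longrightarrow> j \<in> dirs \<Longrightarrow> i \<noteq> j \<Longrightarrow> c j (sh i u) = c i u / s i j u"
  shows "koenigs f"
proof -
  \<comment> \<open>With t = c_i / s_ij, the total coefficient of \<open>\<delta> i u\<close> is t
    (s_ij + a_ij - 1) = - t a_ji, the negative of that of \<open>\<delta> j u\<close>.\<close>
  have step: "c i u *\<^sub>R \<delta> i u + c j (sh i u) *\<^sub>R \<delta> j (sh i u) = (c i u * a j i u / s i j u) *\<^sub>R (\<delta> j u - \<delta> i u)"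
    if ij: "i \<in> dirs" "j \<in> dirs" "i \<noteq> j" for i j u
  proof -
    define t where "t = c i u / s i j u"
    have c: "c i u = t * (1 - a i j u - a j i u)"
      using face_expansion(4)[OF ij, of u] by (simp add: t_def flip: s_def)
    have "c i u *\<^sub>R \<delta> i u + c j (sh i u) *\<^sub>R \<delta> j (sh i u) = (t * a j i u) *\<^sub>R (\<delta> j u - \<delta> i u)"
      unfolding shift[OF ij] t_def[symmetric] \<delta>_shift[OF ij] unfolding c by (simp add: algebra_simps)
    then show ?thesis by (simp add: t_def)
  qed
  have "\<exists>fs. \<forall>u. fs u \<in> (UNIV :: 'a set) \<and> (\<forall>i\<in>dirs. fs (sh i u) = fs u + c i u *\<^sub>R \<delta> i u)"
  proof (rule flat_transport_exists)
    fix i u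
    show "bij_betw (\<lambda>x. x + c i u *\<^sub>R \<delta> i u) UNIV UNIV"
      by (rule bij_betw_byWitness[where f' = "\<lambda>x. x - c i u *\<^sub>R \<delta> i u"]) auto
  next
    fix i j u and x :: 'a
    assume ij: "i \<in> dirs" "j \<in> dirs" "i \<noteq> j"
    have sc: "s j i u = s i j u" by (simp add: s_def)
    have "c j u *\<^sub>R \<delta> j u + c i (sh j u) *\<^sub>R \<delta> i (sh j u) = (c j u * a i j u / s i j u) *\<^sub>R (\<delta> i u - \<delta> j u)"
      using step[OF ij(2,1) ij(3)[symmetric], of u] unfolding sc .
    also have "\<dots> = (c i u * a j i u / s i j u) *\<^sub>R (\<delta> j u - \<delta> i u)"
      unfolding ratio[OF ij] by (simp add: algebra_simps)
    also have "\<dots> = c i u *\<^sub>R \<delta> i u + c j (sh i u) *\<^sub>R \<delta> j (sh i u)"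
      using step[OF ij] by simp
    finally show "x + c j u *\<^sub>R \<delta> j u + c i (sh j u) *\<^sub>R \<delta> i (sh j u) =
      x + c i u *\<^sub>R \<delta> i u + c j (sh i u) *\<^sub>R \<delta> j (sh i u)"
      by (simp add: add.assoc)
  qed simp
  then obtain fs :: "lat \<Rightarrow> 'a" where fs: "\<And>u i. i \<in> dirs \<Longrightarrow> fs (sh i u) = fs u + c i u *\<^sub>R \<delta> i u"
    by blast
  have diag: "fs (sh j (sh i u)) - fs u = (c i u * a j i u / s i j u) *\<^sub>R (\<delta> j u - \<delta> i u)"
    if ij: "i \<in> dirs" "j \<in> dirs" "i \<noteq> j" for i j u
    using step[OF ij, of u] ij by (simp add: fs)
  have edge: "fs (sh i u) - fs u = c i u *\<^sub>R \<delta> i u" if "i \<in> dirs" for i u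
    using that by (simp add: fs)
  have "qnet fs"
    unfolding qnet_def quad_iff_coefficients
  proof (intro allI impI conjI)
    fix u i j assume ij: "i \<in> dirs" "j \<in> dirs" "i \<noteq> j"
    show "indep2 (fs (sh i u) - fs u) (fs (sh j u) - fs u)"
      unfolding edge[OF ij(1)] edge[OF ij(2)] by (intro indep2_scale face_expansion(1) nz ij)
    note an = face_expansion(3)[OF ij, of u] face_expansion(3)[OF ij(2,1) ij(3)[symmetric], of u] face_expansion(4,5)[OF ij, of u]
    let ?b = "- a j i u / s i j u" and ?d = "- a i j u / s i j u"
    have "?d * c j u = c i u * a j i u / s i j u"
      unfolding ratio[OF ij] by simp
    then have "fs (sh j (sh i u)) - fs u = ?b *\<^sub>R (fs (sh i u) - fs u) + ?d *\<^sub>R (fs (sh j u) - fs u)"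
      unfolding edge[OF ij(1)] edge[OF ij(2)] diag[OF ij] scaleR_scaleR
      by (simp only:) (simp add: algebra_simps)
    moreover have "?b \<noteq> 0" "?d \<noteq> 0" using an by auto
    \<comment> \<open>This quotient is never 1, and it is nonzero since the diagonals of the
      original face are not parallel, that is, \<open>s i j u \<noteq> 1\<close>.\<close>
    moreover have sum: "?b + ?d = (s i j u - 1) / s i j u"
      by (simp add: s_def diff_divide_distrib)
    moreover have "?b + ?d \<noteq> 0" "?b + ?d \<noteq> 1" unfolding sum using an by (auto simp: field_simps)
    ultimately show "\<exists>b d. fs (sh j (sh i u)) - fs u = b *\<^sub>R (fs (sh i u) - fs u) + d *\<^sub>R (fs (sh j u) - fs u) \<and>
      b \<noteq> 0 \<and> d \<noteq> 0 \<and> b + d \<noteq> 0 \<and> b + d \<noteq> 1" by blast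
  qed
  moreover have "dual_quad (f u) (f (sh i u)) (f (sh j (sh i u))) (f (sh j u))
                  (fs u) (fs (sh i u)) (fs (sh j (sh i u))) (fs (sh j u))"
    if ij: "i \<in> dirs" "j \<in> dirs" "i \<noteq> j" for u i j
  proof -
    have par: "parallel v w" if "v = t *\<^sub>R w" for v w :: 'a and t
      using that unfolding parallel_def by blast
    have "fs (sh i u) - fs u = c i u *\<^sub>R (f (sh i u) - f u)"
      using edge[OF ij(1)] by (simp add: \<delta>_def)
    moreover have "fs (sh j (sh i u)) - fs (sh i u) = c j (sh i u) *\<^sub>R (f (sh j (sh i u)) - f (sh i u))"
      using edge[OF ij(2)] by (simp add: \<delta>_def)
    moreover have "fs (sh j u) - fs (sh j (sh i u)) = c i (sh j u) *\<^sub>R (f (sh j u) - f (sh j (sh i u)))"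
      using edge[OF ij(1), of "sh j u"] by (simp add: \<delta>_def sh_commute[of j i] algebra_simps)
    moreover have "fs u - fs (sh j u) = c j u *\<^sub>R (f u - f (sh j u))"
      using edge[OF ij(2), of u] by (simp add: \<delta>_def algebra_simps)
    moreover have "fs (sh j (sh i u)) - fs u = (c i u * a j i u / s i j u) *\<^sub>R (f (sh j u) - f (sh i u))"
      using diag[OF ij, of u] by (simp add: \<delta>_def)
    moreover have "fs (sh j u) - fs (sh i u) = (- c i u / a i j u) *\<^sub>R (f (sh j (sh i u)) - f u)"
    proof -
      have an: "a i j u \<noteq> 0" using face_expansion(3)[OF ij] .
      have "c j u = - c i u / a i j u * a j i u" using ratio[OF ij, of u] an by (simp add: field_simps)
      moreover have "fs (sh j u) - fs (sh i u) = (- c i u) *\<^sub>R \<delta> i u + c j u *\<^sub>R \<delta> j u"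
        using ij by (simp add: fs)
      moreover have "- c i u = - c i u / a i j u * a i j u" using an by simp
      ultimately show ?thesis
        unfolding face_expansion(2)[OF ij] scaleR_add_right scaleR_scaleR by metis
    qed
    ultimately show ?thesis unfolding dual_quad_def by (intro conjI par)
  qed
  ultimately show ?thesis using qnet unfolding koenigs_def by blast
qed

lemma K_imp_koenigs:
  assumes K: "\<And>u. K u"
  shows "koenigs f"
proof -
  have s_comm: "s j i u = s i j u" for i j u by (simp add: s_def)
  have an: "a i j u \<noteq> 0" if "i \<in> dirs" "j \<in> dirs" "i \<noteq> j" for i j u using face_expansion(3) that by blast
  have sn: "s i j u \<noteq> 0" if "i \<in> dirs" "j \<in> dirs" "i \<noteq> j" for i j u using face_expansion(4) that by blast
  \<comment> \<open>\<open>corner\<close> will make the transport factor independent of the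
    auxiliary direction, and \<open>opposite\<close> will make the transport flat.\<close>
  have corner: "s i j u * a j k (sh i u) + s i k u * a k j (sh i u) = 0"
    and opposite: "a i j u * s i k (sh j u) + a j i u * s j k (sh i u) = 0"
    if p: "dirs = {i, j, k}" for i j k u
  proof -
    have p2: "dirs = {i, k, j}" and p3: "dirs = {j, i, k}" and p4: "dirs = {j, k, i}" using p by auto
    obtain F where F: "\<And>i j k. dirs = {i, j, k} \<Longrightarrow> a j k (sh i u) = F j / a j i u"
      "\<And>i j k. dirs = {i, j, k} \<Longrightarrow>
        F j / a j i u * s i j u + F k / a k i u * s i k u = 1 - F 1 - F 2 - F 3"
      "\<And>i. i \<in> dirs \<Longrightarrow> F i \<noteq> 0"
      using hex_coordinates by metis
    have sum: "F 1 + F 2 + F 3 = 1" using K_iff_sum F(2,3) K by blast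
    then have sum': "1 - F 1 - F 2 - F 3 = 0" "F i + F j + F k = 1"
      using dirs_eqD(7)[OF p] by auto
    show "s i j u * a j k (sh i u) + s i k u * a k j (sh i u) = 0"
      unfolding F(1)[OF p] F(1)[OF p2] using F(2)[OF p] sum' by (simp add: mult.commute)
    note d = dirs_eqD(1-6)[OF p]
    have "a i j u * (1 - F i / a i j u - F k / a k j u) + a j i u * (1 - F j / a j i u - F k / a k i u) = 0"
    proof (rule hex_opposite_corner)
      show "F j / a j i u * s i j u + F k / a k i u * s i k u = 0" using F(2)[OF p] sum' by simp
      show "F i / a i j u * s i j u + F k / a k j u * s j k u = 0"
        using F(2)[OF p3] sum' by (simp add: s_comm[of j i])
      show "a i j u * a j k u * a k i u + a j i u * a k j u * a i k u = 0" using K K_perm[OF p] by blast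
    qed (use an d sum'(2) in \<open>simp_all add: s_def\<close>)
    then show "a i j u * s i k (sh j u) + a j i u * s j k (sh i u) = 0"
      unfolding s_def F(1)[OF p] F(1)[OF p2] F(1)[OF p3] F(1)[OF p4] by simp
  qed
  \<comment> \<open>A solution of the three ratio conditions at \<open>u\<close>, unique up to a
    factor: the pairs (1,2) and (2,3) determine it, and the pair (1,3) is then (K).\<close>
  define g where "g i u = (if i = 1 then a 1 2 u else if i = 2 then - a 2 1 u
      else a 2 1 u * a 3 2 u / a 2 3 u)" for i :: nat and u
  have gn: "g i u \<noteq> 0" if "i \<in> dirs" for i u
    using an by (auto simp: g_def dirs_def)
  have g: "g i u * a j i u = - (g j u * a i j u)" if "i \<in> dirs" "j \<in> dirs" "i \<noteq> j" for i j u
  proof -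
    have "a 2 3 u \<noteq> 0" using an by (simp add: dirs_def)
    then have "a 1 2 u * a 3 1 u = - (a 2 1 u * a 3 2 u / a 2 3 u * a 1 3 u)"
      using K[of u] unfolding K_def by (simp add: field_simps)
    then show ?thesis using that \<open>a 2 3 u \<noteq> 0\<close> by (auto simp: g_def dirs_def)
  qed
  \<comment> \<open>\<open>T i u\<close> is the ratio \<open>\<rho> (sh i u) / \<rho> u\<close> forced on the coefficients \<open>\<rho> u * g i u\<close> by the shift rule in
    direction \<open>j\<close>; it does not depend on the choice of \<open>j \<noteq> i\<close>.\<close>
  define T where "T i u = (let j = if i = 1 then 2 else 1 in g i u / (s i j u * g j (sh i u)))" for i u
  have T: "T i u = g i u / (s i j u * g j (sh i u))" if ij: "i \<in> dirs" "j \<in> dirs" "i \<noteq> j" for i j u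
  proof -
    have indep: "s i j u * g j (sh i u) = s i k u * g k (sh i u)" if p: "dirs = {i, j, k}" for j k
    proof -
      note d = dirs_eqD(1-6)[OF p]
      have "g k (sh i u) * (s i j u * a j k (sh i u)) = - (g k (sh i u) * (s i k u * a k j (sh i u)))"
        using corner[OF p, of u] by (simp add: eq_neg_iff_add_eq_0 flip: distrib_left)
      moreover have "g k (sh i u) * a j k (sh i u) = - (g j (sh i u) * a k j (sh i u))"
        using g[OF d(2,3,6), of "sh i u"] by simp
      ultimately have "(s i j u * g j (sh i u)) * a k j (sh i u) = (s i k u * g k (sh i u)) * a k j (sh i u)"
        by (simp add: algebra_simps)
      then show ?thesis using an d by simp
    qed
    define l where "l = (if i = 1 then 2 else 1 :: nat)"
    have l: "l \<in> dirs" "i \<noteq> l" using ij by (auto simp: l_def dirs_def)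
    have "s i j u * g j (sh i u) = s i l u * g l (sh i u)"
    proof (cases "j = l")
      case False
      obtain k where k: "dirs = {i, j, k}" using dirs_third[OF ij] .
      then have "k = l" using l False by auto
      then show ?thesis using indep k by blast
    qed simp
    then show ?thesis unfolding T_def Let_def l_def[symmetric] by simp
  qed
  have Tn: "T i u \<noteq> 0" if i: "i \<in> dirs" for i u
  proof -
    obtain j where "j \<in> dirs" "i \<noteq> j" using dirs_other[OF i] .
    then show ?thesis using T gn sn i by simp
  qed
  have "\<exists>\<rho>. \<forall>u. \<rho> u \<in> UNIV - {0 :: real} \<and> (\<forall>i\<in>dirs. \<rho> (sh i u) = T i u * \<rho> u)"
  proof (rule flat_transport_exists)
    fix i u assume "i \<in> dirs"
    then show "bij_betw (\<lambda>x. T i u * x) (UNIV - {0}) (UNIV - {0})"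
      by (intro bij_betw_byWitness[where f' = "\<lambda>x. x / T i u"]) (auto simp: Tn)
  next
    fix i j u and x :: real
    assume ij: "i \<in> dirs" "j \<in> dirs" "i \<noteq> j"
    then obtain k where p: "dirs = {i, j, k}" using dirs_third by metis
    note d = dirs_eqD(1-6)[OF p]
    note n = gn[OF d(1)] gn[OF d(2)] gn[OF d(3)] sn[OF d(1,2,4)] sn[OF d(1,3,5)] sn[OF d(2,3,6)]
      an[OF d(1,2,4), of u]
    \<comment> \<open>The second step of either path uses the third direction \<open>k\<close>, so
      both products end with the same \<open>g k (sh j (sh i u))\<close> while the intermediate
      values of \<open>g\<close> cancel.\<close>
    have 1: "T j (sh i u) * T i u = g i u / (s i j u * s j k (sh i u) * g k (sh j (sh i u)))"
      unfolding T[OF d(1,2,4)] T[OF d(2,3,6)] using n by (simp add: field_simps)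
    have 2: "T i (sh j u) * T j u = g j u / (s i j u * s i k (sh j u) * g k (sh j (sh i u)))"
      unfolding T[OF d(2,1) d(4)[symmetric]] T[OF d(1,3,5)] s_comm[of j i] sh_commute[of i j]
      using n by (simp add: field_simps)
    have "a i j u * (g i u * s i k (sh j u)) = - (g i u * a j i u * s j k (sh i u))"
      using opposite[OF p, of u] by (simp add: eq_neg_iff_add_eq_0 algebra_simps flip: distrib_left)
    also have "\<dots> = a i j u * (g j u * s j k (sh i u))"
      unfolding g[OF d(1,2,4)] by simp
    finally have "g i u * s i k (sh j u) = g j u * s j k (sh i u)" using n by simp
    then have "T i (sh j u) * T j u = T j (sh i u) * T i u"
      unfolding 1 2 using n by (simp add: field_simps)
    then show "T i (sh j u) * (T j u * x) = T j (sh i u) * (T i u * x)"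
      by (simp flip: mult.assoc)
  next
    show "(1::real) \<in> UNIV - {0}" by simp
  qed
  then obtain \<rho> :: "lat \<Rightarrow> real" where \<rho>: "\<And>u. \<rho> u \<noteq> 0" "\<And>i u. i \<in> dirs \<Longrightarrow> \<rho> (sh i u) = T i u * \<rho> u"
    by blast
  show ?thesis
  proof (rule dual_net_of_coefficients)
    fix i u assume "i \<in> dirs"
    then show "\<rho> u * g i u \<noteq> 0" using \<rho> gn by simp
  next
    fix i j u assume ij: "i \<in> dirs" "j \<in> dirs" "i \<noteq> j"
    show "\<rho> u * g i u * a j i u = - (\<rho> u * g j u * a i j u)"
      using g[OF ij, of u] by (simp add: mult.assoc)
    show "\<rho> (sh i u) * g j (sh i u) = \<rho> u * g i u / s i j u"
      unfolding \<rho>(2)[OF ij(1)] T[OF ij] using gn[OF ij(2)] sn[OF ij] by (simp add: field_simps)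
  qed
qed

end

theorem mainTheorem6:
  fixes f :: "int \<times> int \<times> int \<Rightarrow> real ^ 'n"
  assumes "CARD('n) \<ge> 3"
    and "qnet f"
    and "\<forall>u. nondeg_hex f u"
  shows "(\<forall>u. coplanar {f u, f (sh 2 (sh 1 u)), f (sh 3 (sh 2 u)), f (sh 3 (sh 1 u))}
            \<longleftrightarrow> coplanar {f (sh 1 u), f (sh 2 u), f (sh 3 u), f (sh 3 (sh 2 (sh 1 u)))})
       \<and> (koenigs f \<longleftrightarrow>
            (\<forall>u. coplanar {f u, f (sh 2 (sh 1 u)), f (sh 3 (sh 2 u)), f (sh 3 (sh 1 u))}))"
proof -
  interpret nondeg_qnet f
    using assms by unfold_locales auto
  show ?thesis
    using coplanar_even_iff_odd coplanar_even_iff koenigs_imp_K K_imp_koenigs by blast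
qed

end
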